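(* Let $(K;\mathcal{T})$ be a triangulated 3-dimensional pseudo-manifold (with or without boundary) and let $(0,\kappa)$ be prescribed area-curvature functions (with area function identically $0$). Let $V_1,\dots,V_m$ be the vertex solutions. Then the following are equivalent: (1) $(K;\mathcal{T})$ admits a semi-angle structure with area-curvature $(0,\kappa)$; (2) $\chi^*(s)\le\chi^{(0,\kappa)}(s)$ for all $s\in C(K;\mathcal{T})$ with all quadrilateral coordinates non-negative; (3) $\chi(S)=\chi^{(0,\kappa)}(\overline{S})$ for each vertex linking normal surface $S$, and for all $s\in PC(K;\mathcal{T})$ one has $\chi^*(s)\le\chi^{(0,\kappa)}(s)$; (4) $\chi(S)=\chi^{(0,\kappa)}(\overline{S})$ for each vertex linking normal surface $S$, and for all vertex solutions $V_i$, $i=1,\dots,m$, one has $\chi^*(V_i)\le\chi^{(0,\kappa)}(V_i)$.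
   Context: **Pseudo-manifolds.** Let $X$ be a disjoint union of compact 3-simplices $\sigma^3_1,\dots,\sigma^3_t$ and $\Phi=\{\phi_1,\dots,\phi_r\}$ a collection of affine isomorphisms $\phi_i:\tau_i\to\delta_i$ between distinct codimension-one faces of the simplices, with $\{\tau_i,\delta_i\}\cap\{\tau_j,\delta_j\}=\emptyset$ for $i\ne j$. The quotient $K=X/\Phi$ is a compact 3-dimensional pseudo-manifold and the images of the simplices and their sub-simplices form its triangulation $\mathcal{T}$, with cells called vertices, edges, triangles, tetrahedra. It has boundary (the images of unpaired faces) if some face is unpaired; otherwise it is closed. Let $e_1,\dots,e_n$ be the edges. **Normal disc types.** A normal disc in a tetrahedron is a properly embedded disc meeting each face in one normal arc (a properly embedded arc joining the interiors of two distinct edges of the face) or not at all. Up to normal isotopy (isotopy preserving each cell) each tetrahedron has four normal triangle types (each cutting off a corner and meeting the three edges there) and three normal quadrilateral types (each separating a pair of opposite edges and meeting the other four edges). A quadrilateral type faces the two edges of its tetrahedron disjoint from it. Let $N_\square=\{q_1,\dots,q_{3t}\}$ and $N_\Delta=\{p_1,\dots,p_{4t}\}$ be the sets of all quadrilateral and triangle types in $\mathcal{T}$. Identify these types with the standard basis vectors of $\mathbb{R}^{7t}$ (quadrilaterals first). For a normal surface $S$ (a compact surface whose preimage in $X$ is a finite collection of normal discs), its normal coordinate $\overline{S}\in\mathbb{R}^{7t}$ counts the discs of each type. The vertex linking normal surface of a vertex of $\mathcal{T}$ is the normal surface consisting of exactly one normal triangle for each tetrahedron corner at that vertex; $\chi(S)$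 is the usual Euler characteristic. **Solution spaces.** $C(K;\mathcal{T})\subset\mathbb{R}^{7t}$ is the vector space of all $(x_1,\dots,x_{3t},y_1,\dots,y_{4t})$ satisfying, for each pairing $\phi:\tau\to\delta$ in $\Phi$ (with $\tau\subset\sigma^3_i$, $\delta\subset\sigma^3_j$) and each normal arc type in the resulting triangle, $x_q+y_p=x_{q'}+y_{p'}$, where $q,p$ are the quadrilateral and triangle types in $\sigma^3_i$ meeting $\tau$ in that arc type and $q',p'$ those in $\sigma^3_j$ meeting $\delta$ in that arc type. The $x_i$ are the quadrilateral coordinates. $PC(K;\mathcal{T})$ is the convex polytope $C(K;\mathcal{T})\cap\{x\in\mathbb{R}^{7t}:x_i\ge0,\ \sum_{i=1}^{7t}x_i=1\}$ and the vertex solutions $V_1,\dots,V_m$ are its vertices. For each tetrahedron $\sigma^3$, $W_{\sigma^3}$ is the sum of its four triangle types minus the sum of its three quadrilateral types. For each edge $e$ of degree $k$ (formed by gluing $k$ edges $\tilde e_1,\dots,\tilde e_k$ of the unglued tetrahedra), $W_e=\sum_{i=1}^k(p_{s_i}+p_{r_i}-q_{l_i})$, where in the tetrahedron containing $\tilde e_i$, $q_{l_i}$ is the quadrilateral type disjoint from $\tilde e_i$ and $p_{s_i},p_{r_i}$ are the two triangle types meeting $\tilde e_i$. By a theorem of Kang and Rubinstein, $W_{\sigma^3_1},\dots,W_{\sigma^3_t},W_{e_1},\dots,W_{e_n}$ is a basis of $C(K;\mathcal{T})$. **Generalised Euler characteristic.** $\chi^*:\mathbb{R}^{7t}\to\mathbb{R}$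 is the linear function $\chi^*(x,y)=\sum_i x_i\chi^*(q_i)+\sum_j y_j\chi^*(p_j)$, where, with $d(e)$ the degree of $e$ and $b(D)$ the number of normal arcs in $D\cap\partial K$, $\chi^*(p)=-\tfrac12(1+b(p))+\sum_{a=0}^2\tfrac1{d(e_a)}$ for a triangle type meeting edges $e_0,e_1,e_2$ (with multiplicity) and $\chi^*(q)=-\tfrac12(2+b(q))+\sum_{a=0}^3\tfrac1{d(e_a)}$ for a quadrilateral type meeting edges $e_0,\dots,e_3$ (with multiplicity). **Angle structures with area-curvature $(0,\kappa)$.** A quadrilateral disc separates the interior of a 3-simplex into two wedges; up to normal isotopy there are six wedges in each 3-simplex, one for each edge of it. A generalised angle structure on $(K;\mathcal{T})$ is a real-valued function on the set of all wedges (of all tetrahedra). The combinatorial area of a triangle type is the sum of the angles of the three wedges at the three edges it meets, minus $\pi$. The curvature at an edge $e$ is $2\pi$ (if the interior of $e$ lies in the interior of $K$) or $\pi$ (if $e\subset\partial K$) minus the sum of the angles of all wedges containing $e$. Here $\kappa:\{\text{edges}\}\to\mathbb{R}$ is a given function. A semi-angle structure with area-curvature $(0,\kappa)$ is a generalised angle structure with all angles non-negative, with area $0$ for every normal triangle type and with curvature $\kappa(e)$ at each edge $e$. **The function $\chi^{(0,\kappa)}$.** It is the linear function on $C(K;\mathcal{T})$ given, for $s=\sum_{i=1}^t w_iW_{\sigma^3_i}+\sum_{j=1}^n z_jW_{e_j}$, by $\chi^{(0,\kappa)}(s)=\frac1{2\pi}\sum_{j=1}^n 2z_j\kappa(e_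j)$.
   Formalization: The formal statement additionally assumes that no edge of the triangulation is identified with itself in reversed direction; with such an edge, the Euler characteristic of a vertex link differs from χ*, and (1) need not imply (3) or (4). *)

theory Defs
  imports "HOL-Analysis.Analysis"
begin

text \<open>
  The tetrahedra are indexed by a finite type \<open>'t\<close>; the vertices of each are the elements of the
  four-element type \<open>4\<close>.  The face of tetrahedron \<open>i\<close> opposite its vertex \<open>u\<close> is \<open>(i, u)\<close>, and
  the edges of a tetrahedron are the two-element sets of its vertices.

  An affine isomorphism from the face \<open>(i, u)\<close> onto a face of tetrahedron \<open>j\<close> is determined by
  its effect on the three vertices of \<open>(i, u)\<close>.  It is stored as the tuple \<open>(i, u, j, \<pi>)\<close>, where
  \<open>\<pi>\<close> is the unique extension of that bijection to a permutation of \<open>4\<close>; the target face is then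
  \<open>(j, \<pi> u)\<close>.
\<close>

type_synonym 't pairing = "'t \<times> 4 \<times> 't \<times> (4 \<Rightarrow> 4)"

fun paired_faces :: "'t pairing \<Rightarrow> ('t \<times> 4) set" where
  "paired_faces (i, u, j, \<pi>) = {(i, u), (j, \<pi> u)}"

definition is_edge :: "4 set \<Rightarrow> bool" where
  "is_edge e \<longleftrightarrow> card e = 2"

text \<open>
  The identifications that the pairings induce on tetrahedron corners, on edges and on directed
  edges of the unglued tetrahedra.
\<close>

definition glue_corner :: "'t pairing set \<Rightarrow> ('t \<times> 4) rel" where
  "glue_corner \<Phi> = {((i, a), (j, \<pi> a)) | i a j \<pi>. \<exists>u. (i, u, j, \<pi>) \<in> \<Phi> \<and> a \<noteq> u}"

definition glue_edge :: "'t pairing set \<Rightarrow> ('t \<times> 4 set) rel" where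
  "glue_edge \<Phi> = {((i, e), (j, \<pi> ` e)) | i e j \<pi>. \<exists>u. (i, u, j, \<pi>) \<in> \<Phi> \<and> is_edge e \<and> u \<notin> e}"

definition glue_directed_edge :: "'t pairing set \<Rightarrow> ('t \<times> 4 \<times> 4) rel" where
  "glue_directed_edge \<Phi> =
    {((i, a, b), (j, \<pi> a, \<pi> b)) | i a b j \<pi>. \<exists>u. (i, u, j, \<pi>) \<in> \<Phi> \<and> a \<noteq> b \<and> a \<noteq> u \<and> b \<noteq> u}"

definition equiv_closure :: "'a rel \<Rightarrow> 'a rel" where
  "equiv_closure r = (r \<union> r\<inverse>)\<^sup>*"

text \<open>
  The last condition says that no edge is glued to itself with its direction reversed.  It is what
  makes the image of every open edge an open 1-cell of the quotient; for tetrahedra and triangles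
  the corresponding property follows from the other two conditions.
\<close>

definition triangulated_pseudo_manifold :: "'t::finite pairing set \<Rightarrow> bool" where
  "triangulated_pseudo_manifold \<Phi> \<longleftrightarrow>
    (\<forall>(i, u, j, \<pi>) \<in> \<Phi>. bij \<pi> \<and> (i, u) \<noteq> (j, \<pi> u)) \<and>
    (\<forall>\<phi>\<in>\<Phi>. \<forall>\<psi>\<in>\<Phi>. \<phi> \<noteq> \<psi> \<longrightarrow> paired_faces \<phi> \<inter> paired_faces \<psi> = {}) \<and>
    (\<forall>i a b. a \<noteq> b \<longrightarrow> ((i, a, b), (i, b, a)) \<notin> equiv_closure (glue_directed_edge \<Phi>))"

text \<open>
  A vertex of the triangulation is the set of tetrahedron corners glued to form it, and an edge of
  the triangulation is the set of tetrahedron edges glued to form it.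
\<close>

definition vertices :: "'t pairing set \<Rightarrow> ('t \<times> 4) set set" where
  "vertices \<Phi> = UNIV // equiv_closure (glue_corner \<Phi>)"

definition edges :: "'t pairing set \<Rightarrow> ('t \<times> 4 set) set set" where
  "edges \<Phi> = {(i, e). is_edge e} // equiv_closure (glue_edge \<Phi>)"

definition edge_class :: "'t pairing set \<Rightarrow> 't \<Rightarrow> 4 set \<Rightarrow> ('t \<times> 4 set) set" where
  "edge_class \<Phi> i e = equiv_closure (glue_edge \<Phi>) `` {(i, e)}"

definition degree :: "('t \<times> 4 set) set \<Rightarrow> nat" where
  "degree E = card E"

definition boundary_face :: "'t pairing set \<Rightarrow> 't \<Rightarrow> 4 \<Rightarrow> bool" where
  "boundary_face \<Phi> i u \<longleftrightarrow> (i, u) \<notin> (\<Union>\<phi>\<in>\<Phi>. paired_faces \<phi>)"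

definition boundary_edge :: "'t pairing set \<Rightarrow> ('t \<times> 4 set) set \<Rightarrow> bool" where
  "boundary_edge \<Phi> E \<longleftrightarrow> (\<exists>(i, e)\<in>E. \<exists>u. u \<notin> e \<and> boundary_face \<Phi> i u)"

text \<open>
  The three quadrilateral types of a tetrahedron correspond to its three pairs of opposite edges:
  \<open>faced_edges q\<close> is the pair separated by (and hence disjoint from) \<open>q\<close>.
\<close>

datatype quad = Q01 | Q02 | Q03

instance quad :: finite
proof
  have "(UNIV :: quad set) \<subseteq> {Q01, Q02, Q03}"
    using quad.exhaust by blast
  then show "finite (UNIV :: quad set)"
    by (rule finite_subset) simp
qed

fun faced_edges :: "quad \<Rightarrow> 4 set set" where
  "faced_edges Q01 = {{0, 1}, {2, 3}}"
| "faced_edges Q02 = {{0, 2}, {1, 3}}"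
| "faced_edges Q03 = {{0, 3}, {1, 2}}"

definition met_edges :: "quad \<Rightarrow> 4 set set" where
  "met_edges q = {e. is_edge e \<and> e \<notin> faced_edges q}"

text \<open>
  \<open>Inl (i, q)\<close> is the quadrilateral type \<open>q\<close> in tetrahedron \<open>i\<close>, and \<open>Inr (i, v)\<close> is the triangle
  type cutting off the corner \<open>v\<close> of tetrahedron \<open>i\<close>.
\<close>

type_synonym 't disc = "('t \<times> quad) + ('t \<times> 4)"

text \<open>
  A normal arc type in the face opposite \<open>u\<close> is given by the vertex \<open>v \<noteq> u\<close> of that face which it
  cuts off, i.e. it joins the two edges of the face that contain \<open>v\<close>.  The triangle at \<open>v\<close> meets the
  face in this arc type, and so does one quadrilateral type.
\<close>

definition quad_has_arc :: "quad \<Rightarrow> 4 \<Rightarrow> 4 \<Rightarrow> bool" where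
  "quad_has_arc q u v \<longleftrightarrow> (\<forall>e. is_edge e \<and> u \<notin> e \<longrightarrow> (e \<in> met_edges q \<longleftrightarrow> v \<in> e))"

definition arc_weight :: "real ^ 't::finite disc \<Rightarrow> 't \<Rightarrow> 4 \<Rightarrow> 4 \<Rightarrow> real" where
  "arc_weight x i u v = (\<Sum>q | quad_has_arc q u v. x $ Inl (i, q)) + x $ Inr (i, v)"

definition solution_space :: "'t pairing set \<Rightarrow> (real ^ 't::finite disc) set" where
  "solution_space \<Phi> =
    {x. \<forall>(i, u, j, \<pi>) \<in> \<Phi>. \<forall>v. v \<noteq> u \<longrightarrow> arc_weight x i u v = arc_weight x j (\<pi> u) (\<pi> v)}"

definition projective_solution_space :: "'t pairing set \<Rightarrow> (real ^ 't::finite disc) set" where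
  "projective_solution_space \<Phi> =
    solution_space \<Phi> \<inter> {x. (\<forall>D. 0 \<le> x $ D) \<and> (\<Sum>D\<in>UNIV. x $ D) = 1}"

definition vertex_solutions :: "'t pairing set \<Rightarrow> (real ^ 't::finite disc) set" where
  "vertex_solutions \<Phi> = {V. V extreme_point_of projective_solution_space \<Phi>}"

definition W_tet :: "'t \<Rightarrow> real ^ 't::finite disc" where
  "W_tet i = (\<Sum>v\<in>UNIV. axis (Inr (i, v)) 1) - (\<Sum>q\<in>UNIV. axis (Inl (i, q)) 1)"

definition W_edge :: "('t \<times> 4 set) set \<Rightarrow> real ^ 't::finite disc" where
  "W_edge E =
    (\<Sum>(i, e)\<in>E. (\<Sum>v\<in>e. axis (Inr (i, v)) 1) - (\<Sum>q | e \<in> faced_edges q. axis (Inl (i, q)) 1))"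

definition chi_star_tri :: "'t pairing set \<Rightarrow> 't \<Rightarrow> 4 \<Rightarrow> real" where
  "chi_star_tri \<Phi> i v =
    - (1 / 2) * (1 + real (card {u. u \<noteq> v \<and> boundary_face \<Phi> i u}))
    + (\<Sum>e | is_edge e \<and> v \<in> e. 1 / real (degree (edge_class \<Phi> i e)))"

definition chi_star_quad :: "'t pairing set \<Rightarrow> 't \<Rightarrow> quad \<Rightarrow> real" where
  "chi_star_quad \<Phi> i q =
    - (1 / 2) * (2 + real (card {u. boundary_face \<Phi> i u}))
    + (\<Sum>e\<in>met_edges q. 1 / real (degree (edge_class \<Phi> i e)))"

definition chi_star :: "'t pairing set \<Rightarrow> real ^ 't::finite disc \<Rightarrow> real" where
  "chi_star \<Phi> x =
    (\<Sum>(i, q)\<in>UNIV. x $ Inl (i, q) * chi_star_quad \<Phi> i q) +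
    (\<Sum>(i, v)\<in>UNIV. x $ Inr (i, v) * chi_star_tri \<Phi> i v)"

text \<open>
  The functional with prescribed area \<open>0\<close> and curvature \<open>\<kappa>\<close>.  It is only meaningful on the solution
  space, of which the vectors \<open>W_tet i\<close> and \<open>W_edge E\<close> form a basis.
\<close>

definition chi_curv :: "'t pairing set \<Rightarrow> (('t \<times> 4 set) set \<Rightarrow> real) \<Rightarrow> real ^ 't::finite disc \<Rightarrow> real" where
  "chi_curv \<Phi> \<kappa> s =
    (THE c. \<exists>w z. s = (\<Sum>i\<in>UNIV. w i *\<^sub>R W_tet i) + (\<Sum>E\<in>edges \<Phi>. z E *\<^sub>R W_edge E) \<and>
                  c = 1 / (2 * pi) * (\<Sum>E\<in>edges \<Phi>. 2 * z E * \<kappa> E))"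

text \<open>
  The wedge of tetrahedron \<open>i\<close> at its edge \<open>e\<close> is \<open>(i, e)\<close>; values of an angle function at pairs
  \<open>(i, e)\<close> where \<open>e\<close> is not an edge are irrelevant.
\<close>

definition area :: "('t \<times> 4 set \<Rightarrow> real) \<Rightarrow> 't \<Rightarrow> 4 \<Rightarrow> real" where
  "area \<alpha> i v = (\<Sum>e | is_edge e \<and> v \<in> e. \<alpha> (i, e)) - pi"

definition curvature :: "'t pairing set \<Rightarrow> ('t \<times> 4 set \<Rightarrow> real) \<Rightarrow> ('t \<times> 4 set) set \<Rightarrow> real" where
  "curvature \<Phi> \<alpha> E = (if boundary_edge \<Phi> E then pi else 2 * pi) - (\<Sum>(i, e)\<in>E. \<alpha> (i, e))"

definition semi_angle_structure ::
  "'t pairing set \<Rightarrow> (('t \<times> 4 set) set \<Rightarrow> real) \<Rightarrow> ('t \<times> 4 set \<Rightarrow> real) \<Rightarrow> bool" where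
  "semi_angle_structure \<Phi> \<kappa> \<alpha> \<longleftrightarrow>
    (\<forall>i e. is_edge e \<longrightarrow> 0 \<le> \<alpha> (i, e)) \<and>
    (\<forall>i v. area \<alpha> i v = 0) \<and>
    (\<forall>E\<in>edges \<Phi>. curvature \<Phi> \<alpha> E = \<kappa> E)"

text \<open>
  The vertex linking surface of a vertex \<open>V\<close> has one normal triangle for each corner \<open>(i, a) \<in> V\<close>.
  That triangle has a vertex on each edge \<open>{a, b}\<close> of tetrahedron \<open>i\<close>, near \<open>a\<close>, written
  \<open>(i, a, b)\<close>, and a side in each face opposite some \<open>u \<noteq> a\<close>, written \<open>(i, a, u)\<close>.  Vertices are
  identified like directed edges; sides are identified only across the face containing them.  The
  Euler characteristic is that of the resulting cell decomposition of the surface.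
\<close>

definition link_coordinate :: "('t \<times> 4) set \<Rightarrow> real ^ 't::finite disc" where
  "link_coordinate V = (\<Sum>c\<in>V. axis (Inr c) 1)"

definition glue_side :: "'t pairing set \<Rightarrow> ('t \<times> 4 \<times> 4) rel" where
  "glue_side \<Phi> = {((i, a, u), (j, \<pi> a, \<pi> u)) | i a u j \<pi>. (i, u, j, \<pi>) \<in> \<Phi> \<and> a \<noteq> u}"

definition link_0_cells :: "'t pairing set \<Rightarrow> ('t \<times> 4) set \<Rightarrow> ('t \<times> 4 \<times> 4) set set" where
  "link_0_cells \<Phi> V =
    {(i, a, b). (i, a) \<in> V \<and> a \<noteq> b} // equiv_closure (glue_directed_edge \<Phi>)"

definition link_1_cells :: "'t pairing set \<Rightarrow> ('t \<times> 4) set \<Rightarrow> ('t \<times> 4 \<times> 4) set set" where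
  "link_1_cells \<Phi> V = {(i, a, u). (i, a) \<in> V \<and> a \<noteq> u} // equiv_closure (glue_side \<Phi>)"

definition euler_char_link :: "'t pairing set \<Rightarrow> ('t \<times> 4) set \<Rightarrow> int" where
  "euler_char_link \<Phi> V =
    int (card (link_0_cells \<Phi> V)) - int (card (link_1_cells \<Phi> V)) + int (card V)"

end

theory Submission
  imports Defs
begin

text \<open>
  Throughout, \<open>L\<close> denotes the difference \<open>chi_curv - chi_star\<close> on the solution space (called
  \<open>defect\<close> below).  Each of the conditions of the theorem is a statement about this one linear
  function: a semi-angle structure turns out to be exactly a representation of \<open>L\<close> as a
  non-negative combination of the quadrilateral coordinates.

  To evaluate \<open>L\<close>, write a solution as \<open>s = \<Sum>\<^sub>i w\<^sub>i W\<^sub>i + \<Sum>\<^sub>E z\<^sub>E W\<^sub>E\<close>.  Such a representation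
  exists and is unique, because its coefficients can be read off: \<open>z\<^sub>E\<close> is half the number of
  points (with multiplicity) in which \<open>s\<close> meets a tetrahedron edge in the class \<open>E\<close>.  The matching
  equations say precisely that this number is the same for all members of a class
  (\<open>solution_is_canonical_combination\<close>).  In this basis \<open>chi_curv\<close> is \<open>0\<close> on \<open>W\<^sub>i\<close> and \<open>\<kappa> E / \<pi>\<close>
  on \<open>W\<^sub>E\<close> by definition, while \<open>chi_star\<close> is \<open>1\<close> on \<open>W\<^sub>i\<close>, and on \<open>W\<^sub>E\<close> it is \<open>2\<close> for an interior
  edge and \<open>1\<close> for a boundary edge (\<open>chi_star_canonical_combination\<close>).  The last value depends on
  a boundary edge having exactly two boundary sides, since the tetrahedra around an edge form a
  path or a cycle (\<open>boundary_sides_of_edge\<close>).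

  A generalised angle structure with area zero assigns equal angles to opposite edges of a
  tetrahedron, hence one angle \<open>\<alpha>\<^sub>q\<close> to each quadrilateral type, with sum \<open>\<pi>\<close> in each tetrahedron.
  Comparing values on the basis, it has curvature \<open>\<kappa>\<close> if and only if \<open>\<pi> L(s) = \<Sum>\<^sub>q \<alpha>\<^sub>q s\<^sub>q\<close> for
  all solutions \<open>s\<close>.  Thus a semi-angle structure forces \<open>L \<ge> 0\<close> wherever the quadrilateral
  coordinates are non-negative (\<open>defect_semi_angle_structure\<close>), and the converse is Farkas' lemma
  (\<open>semi_angle_structure_exists\<close>).

  The vertex links are the solutions all of whose quadrilateral coordinates vanish, up to linear
  combination, so \<open>L = 0\<close> on them.  As \<open>chi_star\<close> agrees with the Euler characteristic on a link
  (\<open>euler_char_link_eq_chi_star\<close>), this is the condition on links in the theorem.  Conversely,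
  adding multiples of the links makes the triangle coordinates of any solution non-negative
  without changing \<open>L\<close>, so non-negativity of \<open>L\<close> on the polytope of projective solutions suffices
  (\<open>defect_nonneg_of_links\<close>); and there it may be tested at the extreme points, by Minkowski's
  theorem (\<open>defect_nonneg_of_vertex_solutions\<close>).
\<close>

section \<open>Edges and quadrilaterals of a single tetrahedron\<close>

lemma UNIV_four: "(UNIV::4 set) = {0,1,2,3}"
proof -
  have "(4::4) = 0" by simp
  then show ?thesis unfolding UNIV_4 by (simp only:) blast
qed

lemma forall_four: "(\<forall>u::4. P u) \<longleftrightarrow> P 0 \<and> P 1 \<and> P 2 \<and> P 3"
proof -
  have "(\<forall>u::4. P u) \<longleftrightarrow> (\<forall>u\<in>{0,1,2,3}. P u)"
    unfolding UNIV_four [symmetric] by simp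
  then show ?thesis by (simp only: ball_simps simp_thms)
qed

lemma is_edge_doubleton: "is_edge {a, b} \<longleftrightarrow> a \<noteq> b"
  by (simp add: is_edge_def card_insert_if)

lemma sum_four: "(\<Sum>u\<in>(UNIV::4 set). f u) = f 0 + f 1 + f 2 + f 3" for f :: "4 \<Rightarrow> 'a::comm_monoid_add"
  unfolding UNIV_four by (simp add: add.assoc)

lemma UNIV_quad: "(UNIV::quad set) = {Q01,Q02,Q03}"
  using quad.exhaust by blast

lemma sum_quad: "(\<Sum>q\<in>(UNIV::quad set). f q) = f Q01 + f Q02 + f Q03" for f :: "quad \<Rightarrow> 'a::comm_monoid_add"
  unfolding UNIV_quad by (simp add: add.assoc)

lemma doubleton_cases: "\<forall>a b::4. a \<noteq> b \<longrightarrow> {a, b} \<in> {{0,1},{0,2},{0,3},{1,2},{1,3},{2,3}}"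
  unfolding forall_four by (intro conjI impI) (blast | (erule notE, rule refl))+

lemma doubletons_are_edges: "{{0,1},{0,2},{0,3},{1,2},{1,3},{2,3}} \<subseteq> {e. is_edge e}"
  by (simp only: insert_subset mem_Collect_eq is_edge_doubleton) simp

lemma Collect_is_edge: "{e. is_edge e} = {{0,1},{0,2},{0,3},{1,2},{1,3},{2,3}}"
proof (rule equalityI [OF subsetI doubletons_are_edges])
  fix e :: "4 set" assume "e \<in> {e. is_edge e}"
  then obtain a b where e: "e = {a, b}" and "a \<noteq> b"
    unfolding is_edge_def mem_Collect_eq card_2_iff by blast
  show "e \<in> {{0,1},{0,2},{0,3},{1,2},{1,3},{2,3}}"
    unfolding e using \<open>a \<noteq> b\<close> by (rule doubleton_cases [rule_format])
qed

lemma sum_edges: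
  "(\<Sum>e | is_edge e. f e) = f {0,1} + f {0,2} + f {0,3} + f {1,2} + f {1,3} + f {2,3}"
  for f :: "4 set \<Rightarrow> real"
  unfolding Collect_is_edge by (simp add: doubleton_eq_iff add.assoc)

lemma sum_edges_filter:
  "(\<Sum>e | is_edge e \<and> P e. f e) = (\<Sum>e | is_edge e. if P e then f e else 0)"
  for f :: "4 set \<Rightarrow> real"
  by (simp add: sum.inter_filter [symmetric])

lemma sum_edges_at:
  fixes f :: "4 set \<Rightarrow> real"
  shows "(\<Sum>e | is_edge e \<and> 0 \<in> e. f e) = f {0,1} + f {0,2} + f {0,3}"
    and "(\<Sum>e | is_edge e \<and> 1 \<in> e. f e) = f {0,1} + f {1,2} + f {1,3}"
    and "(\<Sum>e | is_edge e \<and> 2 \<in> e. f e) = f {0,2} + f {1,2} + f {2,3}"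
    and "(\<Sum>e | is_edge e \<and> 3 \<in> e. f e) = f {0,3} + f {1,3} + f {2,3}"
  by (simp_all add: sum_edges_filter sum_edges)

lemma sum_edges_face:
  fixes f :: "4 set \<Rightarrow> real"
  shows "(\<Sum>e | is_edge e \<and> 0 \<notin> e. f e) = f {1,2} + f {1,3} + f {2,3}"
    and "(\<Sum>e | is_edge e \<and> 1 \<notin> e. f e) = f {0,2} + f {0,3} + f {2,3}"
    and "(\<Sum>e | is_edge e \<and> 2 \<notin> e. f e) = f {0,1} + f {0,3} + f {1,3}"
    and "(\<Sum>e | is_edge e \<and> 3 \<notin> e. f e) = f {0,1} + f {0,2} + f {1,2}"
  by (simp_all add: sum_edges_filter sum_edges)

lemma sum_faced_edges:
  fixes f :: "4 set \<Rightarrow> real"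
  shows "(\<Sum>e\<in>faced_edges Q01. f e) = f {0,1} + f {2,3}"
    and "(\<Sum>e\<in>faced_edges Q02. f e) = f {0,2} + f {1,3}"
    and "(\<Sum>e\<in>faced_edges Q03. f e) = f {0,3} + f {1,2}"
  by (simp_all add: doubleton_eq_iff)

lemma sum_met_edges:
  fixes f :: "4 set \<Rightarrow> real"
  shows "(\<Sum>e\<in>met_edges Q01. f e) = f {0,2} + f {0,3} + f {1,2} + f {1,3}"
    and "(\<Sum>e\<in>met_edges Q02. f e) = f {0,1} + f {0,3} + f {1,2} + f {2,3}"
    and "(\<Sum>e\<in>met_edges Q03. f e) = f {0,1} + f {0,2} + f {1,3} + f {2,3}"
  unfolding met_edges_def by (simp_all add: sum_edges_filter sum_edges doubleton_eq_iff)

lemma sum_quads_filter: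
  fixes f :: "quad \<Rightarrow> real"
  shows "(\<Sum>q | P q. f q) =
      (if P Q01 then f Q01 else 0) + (if P Q02 then f Q02 else 0) + (if P Q03 then f Q03 else 0)"
proof -
  have "(\<Sum>q | P q. f q) = (\<Sum>q\<in>UNIV. if P q then f q else 0)"
    using sum.inter_filter [of "UNIV :: quad set" f P] by simp
  then show ?thesis by (simp only: sum_quad)
qed

lemma all_edges:
  "(\<forall>e. is_edge e \<longrightarrow> P e) \<longleftrightarrow> P {0,1} \<and> P {0,2} \<and> P {0,3} \<and> P {1,2} \<and> P {1,3} \<and> P {2,3}"
proof -
  have "(\<forall>e. is_edge e \<longrightarrow> P e) \<longleftrightarrow> (\<forall>e\<in>{e. is_edge e}. P e)" by blast
  then show ?thesis unfolding Collect_is_edge by (simp only: ball_simps simp_thms)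
qed

text \<open>
  Two corners of a face are cut off by arcs of distinct quadrilateral types: the one at \<open>v\<close>
  belongs to the type that keeps \<open>v\<close> together with the vertex \<open>u\<close> off the face.
\<close>

lemma quad_has_arc_iff:
  assumes "u \<noteq> v"
  shows "quad_has_arc q u v \<longleftrightarrow> {u, v} \<in> faced_edges q"
proof -
  have "\<forall>u v. u \<noteq> v \<longrightarrow> quad_has_arc q u v = ({u, v} \<in> faced_edges q)"
    unfolding quad_has_arc_def met_edges_def mem_Collect_eq imp_conjL all_edges is_edge_doubleton forall_four
    by (cases q) (simp_all add: doubleton_eq_iff)
  then show ?thesis using assms by blast
qed

text \<open>
  Every edge is faced by exactly one quadrilateral type.  This turns equations for a function on
  quadrilateral types into equations for the wedges facing them.
\<close>

lemma sum_edges_faced_swap: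
  fixes f :: "4 set \<Rightarrow> real"
  shows "(\<Sum>e | is_edge e. f e * (\<Sum>q | e \<in> faced_edges q. \<beta> q)) = (\<Sum>q\<in>UNIV. \<beta> q * (\<Sum>e\<in>faced_edges q. f e))"
  unfolding sum_edges sum_quad sum_faced_edges
  by (simp add: sum_quads_filter doubleton_eq_iff algebra_simps)

text \<open>
  The three edges at a corner represent the three opposite pairs.  This is why angles that come
  from a function on quadrilateral types give all four triangle types of a tetrahedron the same
  area.
\<close>

lemma sum_quads_at_vertex:
  fixes \<beta> :: "quad \<Rightarrow> real"
  shows "(\<Sum>e | is_edge e \<and> v \<in> e. \<Sum>q | e \<in> faced_edges q. \<beta> q) = (\<Sum>q\<in>UNIV. \<beta> q)"
proof -
  have "\<forall>v. (\<Sum>e | is_edge e \<and> v \<in> e. \<Sum>q | e \<in> faced_edges q. \<beta> q) = (\<Sum>q\<in>UNIV. \<beta> q)"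
    unfolding forall_four sum_edges_at sum_quad
    by (simp add: sum_quads_filter doubleton_eq_iff)
  then show ?thesis by blast
qed

section \<open>Classes of an equivalence closure\<close>

lemma equiv_equiv_closure: "equiv UNIV (equiv_closure r)"
  unfolding equiv_closure_def
  by (intro equivI refl_rtrancl sym_rtrancl trans_rtrancl sym_Un_converse) auto

text \<open>
  The induction principle used for all the gluing relations: what single gluing steps preserve in
  both directions is constant on classes.
\<close>

lemma equiv_closure_invariant:
  assumes "(x, y) \<in> equiv_closure r" and "\<And>x y. (x, y) \<in> r \<Longrightarrow> f x = f y"
  shows "f x = f y"
  using assms(1) unfolding equiv_closure_def
  by (induction rule: rtrancl_induct) (auto dest: assms(2))

lemma equiv_closure_incl: "(x, y) \<in> r \<Longrightarrow> (x, y) \<in> equiv_closure r"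
  unfolding equiv_closure_def by blast

lemma equiv_closure_sym: "(x, y) \<in> equiv_closure r \<Longrightarrow> (y, x) \<in> equiv_closure r"
  using equivE [OF equiv_equiv_closure] symD by metis

lemma equiv_closure_trans:
  "(x, y) \<in> equiv_closure r \<Longrightarrow> (y, z) \<in> equiv_closure r \<Longrightarrow> (x, z) \<in> equiv_closure r"
  unfolding equiv_closure_def by (rule rtrancl_trans)

lemma equiv_closure_class_eq:
  "(x, y) \<in> equiv_closure r \<Longrightarrow> equiv_closure r `` {x} = equiv_closure r `` {y}"
  by (rule equiv_class_eq [OF equiv_equiv_closure])

lemma sum_quotient:
  assumes R: "equiv UNIV R" and "finite A" and closed: "R `` A \<subseteq> A"
  shows "(\<Sum>E\<in>A // R. \<Sum>x\<in>E. f x) = (\<Sum>x\<in>A. f x)"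
proof -
  have sub: "R `` {x} \<subseteq> A" if "x \<in> A" for x
    using closed that by blast
  have "\<Union> (A // R) = A"
    using sub equiv_class_self [OF R] by (fastforce simp: quotient_def)
  moreover have "sum f (\<Union> (A // R)) = (sum \<circ> sum) f (A // R)"
  proof (rule sum.Union_disjoint)
    show "\<forall>E\<in>A // R. finite E"
      using sub \<open>finite A\<close> by (auto simp: quotient_def intro: finite_subset)
    show "\<forall>E\<in>A // R. \<forall>F\<in>A // R. E \<noteq> F \<longrightarrow> E \<inter> F = {}"
      using quotient_disj [OF R] unfolding quotient_def by blast
  qed
  ultimately show ?thesis by simp
qed

text \<open>
  Each class is shared out evenly among its members.  The terms \<open>1 / d(e)\<close> of the generalised
  Euler characteristic arise in this way.
\<close>

lemma card_quotient_eq_sum: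
  assumes R: "equiv UNIV R" and "finite A" and closed: "R `` A \<subseteq> A"
  shows "real (card (A // R)) = (\<Sum>x\<in>A. 1 / real (card (R `` {x})))"
proof -
  have "(\<Sum>x\<in>E. 1 / real (card (R `` {x}))) = 1" if "E \<in> A // R" for E
  proof -
    obtain a where a: "a \<in> A" "E = R `` {a}" using \<open>E \<in> A // R\<close> by (rule quotientE)
    have "R `` {x} = E" if "x \<in> E" for x
      using that equiv_class_eq [OF R] unfolding a(2) by blast
    moreover have "finite E" using a closed \<open>finite A\<close> by (auto intro: finite_subset)
    moreover have "E \<noteq> {}" using a equiv_class_self [OF R] by blast
    ultimately show ?thesis by simp
  qed
  then show ?thesis
    unfolding sum_quotient [OF assms, symmetric] by simp
qed

text \<open>
  A connected graph with \<open>n\<close> vertices has at least \<open>n - 1\<close> edges: every vertex other than the root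
  \<open>x\<close> picks an edge towards a neighbour that is closer to the root, and distinct vertices pick
  distinct edges.
\<close>

lemma card_class_le_card_relation:
  assumes "finite r"
  shows "card (equiv_closure r `` {x}) \<le> card {p \<in> r. fst p \<in> equiv_closure r `` {x}} + 1"
proof -
  define R where "R = r \<union> r\<inverse>"
  define C where "C = equiv_closure r `` {x}"
  define d where "d y = (LEAST n. (x, y) \<in> R ^^ n)" for y
  have C: "y \<in> C \<longleftrightarrow> (\<exists>n. (x, y) \<in> R ^^ n)" for y
    unfolding C_def equiv_closure_def R_def [symmetric] by (simp add: rtrancl_is_UN_relpow)
  have "\<exists>p. p \<in> r \<and> fst p \<in> C \<and> (\<exists>y'. d y' < d y \<and> (p = (y, y') \<or> p = (y', y)))"
    if "y \<in> C - {x}" for y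
  proof -
    have dy: "(x, y) \<in> R ^^ d y"
      unfolding d_def using that C by (metis DiffD1 LeastI_ex)
    with that obtain n where n: "d y = Suc n" by (cases "d y") auto
    with dy obtain y' where y': "(x, y') \<in> R ^^ n" "(y', y) \<in> R" by auto
    have "d y' \<le> n" unfolding d_def using y'(1) by (rule Least_le)
    moreover have "y' \<in> C" "y \<in> C" using y'(1) that by (auto simp: C)
    moreover have "(y', y) \<in> r \<or> (y, y') \<in> r" using y'(2) unfolding R_def by blast
    ultimately show ?thesis using n by (metis fst_conv less_Suc_eq_le)
  qed
  then obtain p where p: "\<And>y. y \<in> C - {x} \<Longrightarrow>
      p y \<in> r \<and> fst (p y) \<in> C \<and> (\<exists>y'. d y' < d y \<and> (p y = (y, y') \<or> p y = (y', y)))"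
    by metis
  have "inj_on p (C - {x})"
  proof (rule inj_onI)
    fix y z assume "y \<in> C - {x}" "z \<in> C - {x}" and eq: "p y = p z"
    from p [OF this(1)] p [OF this(2)] eq show "y = z" by (metis less_asym prod.inject)
  qed
  moreover have "p ` (C - {x}) \<subseteq> {q \<in> r. fst q \<in> C}" using p by blast
  ultimately have "card (C - {x}) \<le> card {q \<in> r. fst q \<in> C}"
    using \<open>finite r\<close> by (intro card_inj_on_le) auto
  then show ?thesis
    unfolding C_def [symmetric]
    by (cases "finite C") (auto simp: card_Diff_singleton_if split: if_splits)
qed

section \<open>Linear algebra in a single tetrahedron\<close>

text \<open>
  The number of points in which a surface with normal coordinates \<open>x\<close> meets the edge \<open>e\<close>: the
  triangles at its ends and the quadrilaterals not facing it meet it once each.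
\<close>

definition edge_weight :: "real ^ 't::finite disc \<Rightarrow> 't \<Rightarrow> 4 set \<Rightarrow> real" where
  "edge_weight x i e = (\<Sum>v\<in>e. x $ Inr (i, v)) + (\<Sum>q | e \<notin> faced_edges q. x $ Inl (i, q))"

text \<open>
  Seen from a face containing the edge, its intersection points are the endpoints of the arcs that
  cut off one of its two ends.
\<close>

lemma arc_weight_add:
  assumes "a \<noteq> b" "u \<noteq> a" "u \<noteq> b"
  shows "arc_weight x i u a + arc_weight x i u b = edge_weight x i {a, b}"
proof -
  have "\<forall>u a b. a \<noteq> b \<longrightarrow> u \<noteq> a \<longrightarrow> u \<noteq> b \<longrightarrow>
    arc_weight x i u a + arc_weight x i u b = edge_weight x i {a, b}"
    unfolding arc_weight_def edge_weight_def forall_four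
    by (simp add: quad_has_arc_iff sum_quads_filter doubleton_eq_iff)
  then show ?thesis using assms by blast
qed

text \<open>
  The negative of the coefficient of \<open>W_tet i\<close> in a solution; it comes from solving the seven
  linear equations of a tetrahedron.
\<close>

definition tet_weight :: "real ^ 't::finite disc \<Rightarrow> 't \<Rightarrow> real" where
  "tet_weight x i = (\<Sum>q\<in>UNIV. x $ Inl (i, q)) + (\<Sum>v\<in>UNIV. x $ Inr (i, v)) / 2"

text \<open>
  With \<open>tri_coordinate_eq_weights\<close> this inverts the coordinates of a single tetrahedron: \<open>W_tet\<close>
  and the contributions of the six edges span all of \<open>\<real>\<^sup>7\<close>.
\<close>

lemma quad_coordinate_eq_weights:
  "x $ Inl (i, q) = tet_weight x i - (\<Sum>e\<in>faced_edges q. edge_weight x i e / 2)"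
  unfolding tet_weight_def edge_weight_def sum_quad sum_four
  by (cases q) (simp_all add: sum_quads_filter doubleton_eq_iff field_simps)

lemma tri_coordinate_eq_weights:
  "x $ Inr (i, v) = (\<Sum>e | is_edge e \<and> v \<in> e. edge_weight x i e / 2) - tet_weight x i"
proof -
  have "\<forall>v. x $ Inr (i, v) = (\<Sum>e | is_edge e \<and> v \<in> e. edge_weight x i e / 2) - tet_weight x i"
    unfolding forall_four sum_edges_at tet_weight_def edge_weight_def sum_quad sum_four
    by (simp add: sum_quads_filter doubleton_eq_iff field_simps)
  then show ?thesis by blast
qed

text \<open>
  In tetrahedron \<open>i\<close>, the vector \<open>x\<close> is \<open>w\<close> times \<open>W_tet i\<close> plus, for every edge \<open>e\<close>, \<open>Z e\<close> times
  the two triangle types meeting \<open>e\<close> minus the quadrilateral type facing \<open>e\<close>.  A combination of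
  the canonical basis has this form in each tetrahedron, which reduces global computations to
  linear identities in finitely many variables.
\<close>

locale local_combination =
  fixes x :: "real ^ 't::finite disc" and i :: 't and w :: real and Z :: "4 set \<Rightarrow> real"
  assumes quad: "\<And>q. x $ Inl (i, q) = - w - (\<Sum>e\<in>faced_edges q. Z e)"
    and tri: "\<And>v. x $ Inr (i, v) = w + (\<Sum>e | is_edge e \<and> v \<in> e. Z e)"
begin

lemma edge_weight_eq:
  assumes "is_edge e"
  shows "edge_weight x i e = 2 * Z e"
proof -
  have "\<forall>e. is_edge e \<longrightarrow> edge_weight x i e = 2 * Z e"
    unfolding all_edges edge_weight_def
    by (simp add: sum_quads_filter doubleton_eq_iff quad tri sum_edges_at)
  then show ?thesis using assms by blast
qed

text \<open>
  Only the edges of the face enter, neither \<open>w\<close> nor the other three edges.  Hence the matching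
  equations hold once the values \<open>Z\<close> on the two sides of a gluing agree.
\<close>

lemma arc_weight_eq:
  assumes "u \<noteq> v"
  shows "arc_weight x i u v = (\<Sum>e | is_edge e \<and> u \<notin> e. if v \<in> e then Z e else - Z e)"
proof -
  have "\<forall>u v. u \<noteq> v \<longrightarrow>
    arc_weight x i u v = (\<Sum>e | is_edge e \<and> u \<notin> e. if v \<in> e then Z e else - Z e)"
    unfolding forall_four arc_weight_def sum_edges_face
    by (simp add: quad_has_arc_iff sum_quads_filter quad tri sum_edges_at doubleton_eq_iff)
  then show ?thesis using assms by blast
qed

text \<open>
  The contribution of one tetrahedron to \<open>chi_star\<close>, when \<open>b\<close> is the indicator function of the
  vertices opposite to boundary faces and \<open>\<delta> e\<close> is the reciprocal of the degree of \<open>e\<close>.  The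
  difference \<open>\<Sum>u.  b u - \<Sum>u\<in>e.  b u\<close> then counts the boundary faces that contain \<open>e\<close>.
\<close>

lemma weighted_sum_eq:
  fixes b :: "4 \<Rightarrow> real" and \<delta> :: "4 set \<Rightarrow> real"
  shows "(\<Sum>q\<in>UNIV. x $ Inl (i, q) * (- (1/2) * (2 + (\<Sum>u\<in>UNIV. b u)) + (\<Sum>e\<in>met_edges q. \<delta> e)))
       + (\<Sum>v\<in>UNIV. x $ Inr (i, v) * (- (1/2) * (1 + ((\<Sum>u\<in>UNIV. b u) - b v)) + (\<Sum>e | is_edge e \<and> v \<in> e. \<delta> e)))
       = w + (\<Sum>e | is_edge e. Z e * (2 * \<delta> e - ((\<Sum>u\<in>UNIV. b u) - (\<Sum>u\<in>e. b u)) / 2))"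
  unfolding quad tri sum_quad sum_four sum_edges sum_edges_at sum_faced_edges sum_met_edges
  by (simp add: field_simps)

text \<open>
  If the angle sums at the four corners agree, then opposite edges carry equal angles: the sums at
  the two ends of an edge, minus the sums at the two ends of the opposite edge, give twice the
  difference.
\<close>

lemma angle_pairing_eq:
  fixes \<alpha> :: "4 set \<Rightarrow> real"
  assumes "\<And>v. (\<Sum>e | is_edge e \<and> v \<in> e. \<alpha> e) = c"
  shows "(\<Sum>q\<in>UNIV. x $ Inl (i, q) * ((\<Sum>e\<in>faced_edges q. \<alpha> e) / 2)) = - (w * c) - (\<Sum>e | is_edge e. Z e * \<alpha> e)"
proof -
  have *: "\<alpha> {0,1} + \<alpha> {0,2} + \<alpha> {0,3} = c" "\<alpha> {0,1} + \<alpha> {1,2} + \<alpha> {1,3} = c"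
     "\<alpha> {0,2} + \<alpha> {1,2} + \<alpha> {2,3} = c" "\<alpha> {0,3} + \<alpha> {1,3} + \<alpha> {2,3} = c"
    using assms [of 0] assms [of 1] assms [of 2] assms [of 3] unfolding sum_edges_at by auto
  then have **: "\<alpha> {2,3} = \<alpha> {0,1}" "\<alpha> {1,3} = \<alpha> {0,2}" "\<alpha> {1,2} = \<alpha> {0,3}" by linarith+
  then show ?thesis
    unfolding quad sum_quad sum_edges sum_faced_edges *(1)[symmetric] ** by (simp add: field_simps)
qed

end

section \<open>The canonical basis of the solution space\<close>

definition canonical_combination ::
  "'t pairing set \<Rightarrow> ('t \<Rightarrow> real) \<Rightarrow> (('t \<times> 4 set) set \<Rightarrow> real) \<Rightarrow> real ^ 't::finite disc" where
  "canonical_combination \<Phi> w z =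
    (\<Sum>i\<in>UNIV. w i *\<^sub>R W_tet i) + (\<Sum>E\<in>edges \<Phi>. z E *\<^sub>R W_edge E)"

lemma W_tet_nth:
  "W_tet i $ Inl (j, q) = (if i = j then -1 else 0)"
  "W_tet i $ Inr (j, v) = (if i = j then 1 else 0)"
  unfolding W_tet_def by (cases "i = j"; simp add: axis_def sum_component)+

lemma W_edge_nth:
  "W_edge E $ Inl (j, q) = (\<Sum>(i, e)\<in>E. if i = j then if e \<in> faced_edges q then -1 else 0 else 0)"
  "W_edge E $ Inr (j, v) = (\<Sum>(i, e)\<in>E. if i = j then if v \<in> e then 1 else 0 else 0)"
  unfolding W_edge_def sum_component
  by (auto intro!: sum.cong simp: axis_def sum_component)

lemma link_coordinate_nth:
  "link_coordinate V $ Inl (i, q) = 0"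
  "link_coordinate V $ Inr c = (if c \<in> V then 1 else 0)"
  unfolding link_coordinate_def by (auto simp: axis_def)

locale pseudo_manifold =
  fixes \<Phi> :: "'t::finite pairing set"
  assumes pseudo_manifold: "triangulated_pseudo_manifold \<Phi>"
begin

lemma
  assumes "(i, u, j, \<pi>) \<in> \<Phi>"
  shows bij_pairing: "bij \<pi>" and faces_distinct: "(i, u) \<noteq> (j, \<pi> u)"
  using assms pseudo_manifold unfolding triangulated_pseudo_manifold_def by fast+

lemma inj_pairing: "(i, u, j, \<pi>) \<in> \<Phi> \<Longrightarrow> \<pi> a = \<pi> b \<longleftrightarrow> a = b"
  using bij_pairing by (metis bij_def inj_eq)

lemma pairing_unique:
  assumes "\<phi> \<in> \<Phi>" "\<psi> \<in> \<Phi>" "F \<in> paired_faces \<phi>" "F \<in> paired_faces \<psi>"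
  shows "\<phi> = \<psi>"
  using assms pseudo_manifold unfolding triangulated_pseudo_manifold_def by blast

lemma no_reversed_edge:
  "a \<noteq> b \<Longrightarrow> ((i, a, b), (i, b, a)) \<notin> equiv_closure (glue_directed_edge \<Phi>)"
  using pseudo_manifold unfolding triangulated_pseudo_manifold_def by blast

lemma is_edge_image: "(i, u, j, \<pi>) \<in> \<Phi> \<Longrightarrow> is_edge (\<pi> ` e) \<longleftrightarrow> is_edge e"
  unfolding is_edge_def by (metis bij_def bij_pairing card_image inj_on_subset subset_UNIV)

lemma glued_is_edge:
  assumes "((i, e), (j, f)) \<in> equiv_closure (glue_edge \<Phi>)"
  shows "is_edge e \<longleftrightarrow> is_edge f"
proof -
  have "is_edge (snd (i, e)) \<longleftrightarrow> is_edge (snd (j, f))"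
    using assms by (rule equiv_closure_invariant) (auto simp: glue_edge_def is_edge_image)
  then show ?thesis by simp
qed

lemma edge_set_closed:
  "equiv_closure (glue_edge \<Phi>) `` {(i, e). is_edge e} \<subseteq> {(i, e). is_edge e}"
  using glued_is_edge by blast

lemma edgesE:
  assumes "E \<in> edges \<Phi>"
  obtains i e where "is_edge e" "E = edge_class \<Phi> i e"
  using assms unfolding edges_def edge_class_def by (auto elim!: quotientE)

lemma self_in_edge_class: "(i, e) \<in> edge_class \<Phi> i e"
  unfolding edge_class_def by (rule equiv_class_self [OF equiv_equiv_closure UNIV_I])

lemma mem_edge:
  assumes "E \<in> edges \<Phi>" "(i, e) \<in> E"
  shows "is_edge e" "edge_class \<Phi> i e = E"
proof -
  obtain j f where E: "is_edge f" "E = edge_class \<Phi> j f" using assms(1) by (rule edgesE)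
  then have *: "((j, f), (i, e)) \<in> equiv_closure (glue_edge \<Phi>)"
    using assms(2) unfolding edge_class_def by blast
  show "is_edge e" "edge_class \<Phi> i e = E"
    using E glued_is_edge [OF *] equiv_closure_class_eq [OF *] unfolding edge_class_def by auto
qed

lemma edge_class_glued:
  assumes "(i, u, j, \<pi>) \<in> \<Phi>" "is_edge e" "u \<notin> e"
  shows "edge_class \<Phi> j (\<pi> ` e) = edge_class \<Phi> i e"
proof -
  have "((i, e), (j, \<pi> ` e)) \<in> glue_edge \<Phi>" using assms unfolding glue_edge_def by blast
  then show ?thesis
    unfolding edge_class_def by (metis equiv_closure_class_eq equiv_closure_incl)
qed

text \<open>
  Edge classes partition the edges of all tetrahedra, so a sum over classes becomes a sum over
  tetrahedra.
\<close>

lemma sum_edge_classes: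
  fixes g :: "'t \<Rightarrow> 4 set \<Rightarrow> real"
  shows "(\<Sum>E\<in>edges \<Phi>. z E * (\<Sum>(i, e)\<in>E. g i e))
    = (\<Sum>i\<in>UNIV. \<Sum>e | is_edge e. z (edge_class \<Phi> i e) * g i e)"
proof -
  let ?A = "{(i, e). is_edge e} :: ('t \<times> 4 set) set"
  have "(\<Sum>E\<in>edges \<Phi>. z E * (\<Sum>(i, e)\<in>E. g i e))
    = (\<Sum>E\<in>edges \<Phi>. \<Sum>(i, e)\<in>E. z (edge_class \<Phi> i e) * g i e)"
    by (auto simp: sum_distrib_left mem_edge intro!: sum.cong)
  also have "\<dots> = (\<Sum>(i, e)\<in>?A. z (edge_class \<Phi> i e) * g i e)"
    unfolding edges_def
    by (rule sum_quotient [OF equiv_equiv_closure _ edge_set_closed]) simp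
  also have "?A = UNIV \<times> {e. is_edge e}" by auto
  finally show ?thesis by (simp add: sum.cartesian_product)
qed

lemma local_canonical_combination:
  "local_combination (canonical_combination \<Phi> w z) i (w i) (\<lambda>e. z (edge_class \<Phi> i e))"
proof
  fix q :: quad
  have "canonical_combination \<Phi> w z $ Inl (i, q)
    = - w i + (\<Sum>E\<in>edges \<Phi>. z E * (\<Sum>(j, e)\<in>E. if j = i then if e \<in> faced_edges q then -1 else 0 else 0))"
    unfolding canonical_combination_def
    by (simp add: sum_component W_tet_nth W_edge_nth if_distrib [of "(*) _"] sum.delta cong: if_cong)
  also have "\<dots> = - w i + (\<Sum>e | is_edge e. if e \<in> faced_edges q then - z (edge_class \<Phi> i e) else 0)"
    unfolding sum_edge_classes
    by (subst sum.swap) (simp add: if_distrib [of "(*) _"] sum.delta cong: if_cong)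
  also have "(\<Sum>e | is_edge e. if e \<in> faced_edges q then - z (edge_class \<Phi> i e) else 0)
    = (\<Sum>e\<in>faced_edges q. - z (edge_class \<Phi> i e))"
    unfolding sum_edges by (cases q) (simp_all add: doubleton_eq_iff)
  finally show "canonical_combination \<Phi> w z $ Inl (i, q)
    = - w i - (\<Sum>e\<in>faced_edges q. z (edge_class \<Phi> i e))"
    by (simp add: sum_negf)
next
  fix v :: 4
  have "canonical_combination \<Phi> w z $ Inr (i, v)
    = w i + (\<Sum>E\<in>edges \<Phi>. z E * (\<Sum>(j, e)\<in>E. if j = i then if v \<in> e then 1 else 0 else 0))"
    unfolding canonical_combination_def
    by (simp add: sum_component W_tet_nth W_edge_nth if_distrib [of "(*) _"] sum.delta cong: if_cong)
  also have "\<dots> = w i + (\<Sum>e | is_edge e. if v \<in> e then z (edge_class \<Phi> i e) else 0)"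
    unfolding sum_edge_classes
    by (subst sum.swap) (simp add: if_distrib [of "(*) _"] sum.delta cong: if_cong)
  finally show "canonical_combination \<Phi> w z $ Inr (i, v)
    = w i + (\<Sum>e | is_edge e \<and> v \<in> e. z (edge_class \<Phi> i e))"
    by (simp only: sum_edges_filter)
qed

text \<open>
  By \<open>arc_weight_eq\<close>, the arc weights of a face depend only on the coefficients of the classes of
  its three edges, and gluing respects these classes.
\<close>

lemma canonical_combination_in_solution_space: "canonical_combination \<Phi> w z \<in> solution_space \<Phi>"
  unfolding solution_space_def mem_Collect_eq
proof (clarify)
  fix i u j \<pi> v assume \<phi>: "(i, u, j, \<pi>) \<in> \<Phi>" and "v \<noteq> (u :: 4)"
  let ?x = "canonical_combination \<Phi> w z"
  let ?Z = "\<lambda>i e. z (edge_class \<Phi> i e)"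
  have "arc_weight ?x i u v = (\<Sum>e | is_edge e \<and> u \<notin> e. if v \<in> e then ?Z i e else - ?Z i e)"
    using \<open>v \<noteq> u\<close> by (intro local_combination.arc_weight_eq [OF local_canonical_combination]) auto
  also have "\<dots> = (\<Sum>f | is_edge f \<and> \<pi> u \<notin> f. if \<pi> v \<in> f then ?Z j f else - ?Z j f)"
  proof (rule sum.reindex_bij_witness [of _ "\<lambda>f. \<pi> -` f" "\<lambda>e. \<pi> ` e"])
    fix e assume e: "e \<in> {e. is_edge e \<and> u \<notin> e}"
    show "\<pi> -` (\<pi> ` e) = e" "\<pi> ` e \<in> {f. is_edge f \<and> \<pi> u \<notin> f}"
      using e \<phi> by (auto simp: inj_pairing is_edge_image)
    show "(if \<pi> v \<in> \<pi> ` e then ?Z j (\<pi> ` e) else - ?Z j (\<pi> ` e)) = (if v \<in> e then ?Z i e else - ?Z i e)"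
      using e \<phi> edge_class_glued [OF \<phi>] by (auto simp: inj_pairing)
  next
    fix f assume f: "f \<in> {f. is_edge f \<and> \<pi> u \<notin> f}"
    show *: "\<pi> ` (\<pi> -` f) = f" using bij_pairing [OF \<phi>] by (simp add: bij_def surj_image_vimage_eq)
    show "\<pi> -` f \<in> {e. is_edge e \<and> u \<notin> e}"
      using f is_edge_image [OF \<phi>, of "\<pi> -` f"] * by auto
  qed
  also have "\<dots> = arc_weight ?x j (\<pi> u) (\<pi> v)"
    using \<open>v \<noteq> u\<close> inj_pairing [OF \<phi>]
    by (intro local_combination.arc_weight_eq [OF local_canonical_combination, symmetric]) auto
  finally show "arc_weight ?x i u v = arc_weight ?x j (\<pi> u) (\<pi> v)" .
qed

text \<open>
  The matching equations identify arc weights across a gluing, and edge weights are sums of two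
  arc weights.
\<close>

lemma edge_weight_glued:
  assumes "s \<in> solution_space \<Phi>" "((i, e), (j, f)) \<in> equiv_closure (glue_edge \<Phi>)"
  shows "edge_weight s i e = edge_weight s j f"
proof -
  have "edge_weight s i e = edge_weight s j (\<pi> ` e)"
    if \<phi>: "(i, u, j, \<pi>) \<in> \<Phi>" and "is_edge e" "u \<notin> e" for i u j \<pi> e
  proof -
    obtain a b where e: "e = {a, b}" "a \<noteq> b" using \<open>is_edge e\<close> unfolding is_edge_def card_2_iff by blast
    have arc: "arc_weight s i u v = arc_weight s j (\<pi> u) (\<pi> v)" if "v \<noteq> u" for v
      using assms(1) \<phi> that unfolding solution_space_def by blast
    have "edge_weight s i e = arc_weight s i u a + arc_weight s i u b"
      unfolding e using e \<open>u \<notin> e\<close> by (intro arc_weight_add [symmetric]) auto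
    also have "\<dots> = arc_weight s j (\<pi> u) (\<pi> a) + arc_weight s j (\<pi> u) (\<pi> b)"
      using e \<open>u \<notin> e\<close> by (auto intro!: arg_cong2 [of _ _ _ _ "(+)"] arc)
    also have "\<dots> = edge_weight s j {\<pi> a, \<pi> b}"
      using e \<open>u \<notin> e\<close> by (intro arc_weight_add) (auto simp: inj_pairing [OF \<phi>])
    finally show ?thesis by (simp add: e)
  qed
  then have "edge_weight s (fst x) (snd x) = edge_weight s (fst y) (snd y)" if "(x, y) \<in> glue_edge \<Phi>" for x y
    using that unfolding glue_edge_def by auto
  from equiv_closure_invariant [where f = "\<lambda>x. edge_weight s (fst x) (snd x)", OF assms(2) this]
  show ?thesis by simp
qed

text \<open>
  The spanning half of the theorem of Kang and Rubinstein.  Half the edge weight serves as the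
  coefficient of an edge class; it is well defined by \<open>edge_weight_glued\<close>.
\<close>

lemma solution_is_canonical_combination:
  assumes "s \<in> solution_space \<Phi>"
  obtains w z where "s = canonical_combination \<Phi> w z"
proof
  define w where "w i = - tet_weight s i" for i
  \<comment> \<open>The coefficient of a class is read off from an arbitrary representative.\<close>
  define z where "z E = (let (i, e) = SOME x. x \<in> E in edge_weight s i e / 2)" for E
  have z: "z (edge_class \<Phi> i e) = edge_weight s i e / 2" for i e
  proof -
    have "(SOME x. x \<in> edge_class \<Phi> i e) \<in> edge_class \<Phi> i e"
      using self_in_edge_class by (rule someI)
    then show ?thesis
      unfolding z_def edge_class_def using edge_weight_glued [OF assms, of i e]
      by (auto simp: Let_def split: prod.split)
  qed
  show "s = canonical_combination \<Phi> w z"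
  proof (rule iffD2 [OF vec_eq_iff], rule)
    fix D :: "'t disc"
    note l = local_canonical_combination [of w z, unfolded z]
    show "s $ D = canonical_combination \<Phi> w z $ D"
    proof (cases D)
      case (Inl p)
      then show ?thesis
        using local_combination.quad [OF l, of "fst p" "snd p"] quad_coordinate_eq_weights [of s "fst p" "snd p"]
        by (simp add: w_def)
    next
      case (Inr p)
      then show ?thesis
        using local_combination.tri [OF l, of "fst p" "snd p"] tri_coordinate_eq_weights [of s "fst p" "snd p"]
        by (simp add: w_def)
    qed
  qed
qed

lemma canonical_combination_edge_weight:
  "is_edge e \<Longrightarrow> edge_weight (canonical_combination \<Phi> w z) i e = 2 * z (edge_class \<Phi> i e)"
  by (rule local_combination.edge_weight_eq [OF local_canonical_combination])

text \<open>
  The coefficients of edge classes are recovered as half the edge weights, so the description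
  defining \<open>chi_curv\<close> determines a unique number.
\<close>

lemma chi_curv_canonical_combination:
  "chi_curv \<Phi> \<kappa> (canonical_combination \<Phi> w z) = (\<Sum>E\<in>edges \<Phi>. z E * \<kappa> E) / pi"
proof -
  have "z' E = z E" if "canonical_combination \<Phi> w z = canonical_combination \<Phi> w' z'" "E \<in> edges \<Phi>" for w' z' E
  proof -
    obtain i e where "is_edge e" "E = edge_class \<Phi> i e" using \<open>E \<in> edges \<Phi>\<close> by (rule edgesE)
    then show ?thesis
      using canonical_combination_edge_weight [of e w z i] canonical_combination_edge_weight [of e w' z' i] that(1)
      by simp
  qed
  then have "(\<Sum>E\<in>edges \<Phi>. 2 * z' E * \<kappa> E) = (\<Sum>E\<in>edges \<Phi>. 2 * z E * \<kappa> E)"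
    if "canonical_combination \<Phi> w z = canonical_combination \<Phi> w' z'" for w' z'
    using that by (auto intro: sum.cong)
  then have "chi_curv \<Phi> \<kappa> (canonical_combination \<Phi> w z) = 1 / (2 * pi) * (\<Sum>E\<in>edges \<Phi>. 2 * z E * \<kappa> E)"
    unfolding chi_curv_def canonical_combination_def [symmetric]
    by (intro the_equality) metis+
  then show ?thesis by (simp add: sum_distrib_left sum_divide_distrib mult.assoc)
qed

end

section \<open>The generalised Euler characteristic on the canonical basis\<close>

lemma sum_UNIV_pairs:
  fixes g :: "'a::finite \<Rightarrow> 'b::finite \<Rightarrow> real"
  shows "(\<Sum>(a, b)\<in>UNIV. g a b) = (\<Sum>a\<in>UNIV. \<Sum>b\<in>UNIV. g a b)"
  by (simp add: sum.cartesian_product)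

context pseudo_manifold
begin

text \<open>
  A side of the class \<open>E\<close> is a tetrahedron edge \<open>(i, e) \<in> E\<close> together with one of the two faces of
  \<open>i\<close> that contain it.  If \<open>E\<close> has \<open>n\<close> members, it has \<open>2 n\<close> sides; the pairings match up \<open>2 m\<close> of
  these, and the remaining \<open>2 (n - m)\<close> lie in the boundary.  As \<open>E\<close> is connected by the \<open>m\<close>
  gluings, \<open>n \<le> m + 1\<close>, so there are either no boundary sides or two.
\<close>

lemma boundary_sides_of_edge:
  assumes E: "E \<in> edges \<Phi>"
  shows "(\<Sum>(i, e)\<in>E. card {u. u \<notin> e \<and> boundary_face \<Phi> i u})
    = (if boundary_edge \<Phi> E then 2 else 0)"
proof -
  \<comment> \<open>\<open>P\<close> consists of the sides, \<open>B\<close> of the boundary sides, and \<open>M\<close> of the gluings of sides; \<open>src\<close> and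
    \<open>tgt\<close> are the two sides that a gluing joins.\<close>
  define P where "P = {((i, e), u) | i e u. (i, e) \<in> E \<and> u \<notin> e}"
  define B where "B = {((i, e), u) | i e u. (i, e) \<in> E \<and> u \<notin> e \<and> boundary_face \<Phi> i u}"
  define M where "M = {(i, u, j, \<pi>, e) | i u j \<pi> e. (i, u, j, \<pi>) \<in> \<Phi> \<and> (i, e) \<in> E \<and> u \<notin> e}"
  define src where "src = (\<lambda>(i :: 't, u :: 4, j :: 't, \<pi> :: 4 \<Rightarrow> 4, e). ((i, e :: 4 set), u))"
  define tgt where "tgt = (\<lambda>(i :: 't, u :: 4, j :: 't, \<pi> :: 4 \<Rightarrow> 4, e). ((j, \<pi> ` e), \<pi> u))"
  have "finite M" "finite P" "finite E" by simp_all
  have edge: "is_edge e" if "(i, e) \<in> E" for i e using mem_edge [OF E that] by simp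
  have tgt_E: "(j, \<pi> ` e) \<in> E" if "(i, u, j, \<pi>) \<in> \<Phi>" "(i, e) \<in> E" "u \<notin> e" for i u j \<pi> e
    using edge_class_glued [OF that(1) edge that(3), of i] mem_edge [OF E that(2)] that(2)
      self_in_edge_class [of j "\<pi> ` e"] by simp
  have "inj_on src M"
  proof (rule inj_onI)
    fix m n assume m: "m \<in> M" and n: "n \<in> M" and eq: "src m = src n"
    obtain i u j \<pi> e where m': "m = (i, u, j, \<pi>, e)" "(i, u, j, \<pi>) \<in> \<Phi>"
      using m unfolding M_def by blast
    obtain i' u' j' \<pi>' e' where n': "n = (i', u', j', \<pi>', e')" "(i', u', j', \<pi>') \<in> \<Phi>"
      using n unfolding M_def by blast
    have eq': "i = i'" "u = u'" "e = e'" using eq unfolding m' n' src_def by simp_all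
    then have "(i, u, j, \<pi>) = (i', u', j', \<pi>')"
      using m' n' by (intro pairing_unique [of _ _ "(i, u)"]) auto
    then show "m = n" unfolding m' n' using eq' by simp
  qed
  have "inj_on tgt M"
  proof (rule inj_onI)
    fix m n assume m: "m \<in> M" and n: "n \<in> M" and eq: "tgt m = tgt n"
    obtain i u j \<pi> e where m': "m = (i, u, j, \<pi>, e)" "(i, u, j, \<pi>) \<in> \<Phi>"
      using m unfolding M_def by blast
    obtain i' u' j' \<pi>' e' where n': "n = (i', u', j', \<pi>', e')" "(i', u', j', \<pi>') \<in> \<Phi>"
      using n unfolding M_def by blast
    have eq': "j = j'" "\<pi> ` e = \<pi>' ` e'" "\<pi> u = \<pi>' u'" using eq unfolding m' n' tgt_def by simp_all
    then have "(i, u, j, \<pi>) = (i', u', j', \<pi>')"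
      using m' n' by (intro pairing_unique [of _ _ "(j, \<pi> u)"]) auto
    moreover from this have "e = e'" using eq' inj_pairing [OF m'(2)] by (auto simp: inj_image_eq_iff inj_def)
    ultimately show "m = n" unfolding m' n' by simp
  qed
  have "src ` M \<inter> tgt ` M = {}"
  proof -
    have False if \<phi>: "(i', u', i, \<pi>') \<in> \<Phi>" "(i, \<pi>' u', j, \<pi>) \<in> \<Phi>" for i' u' i \<pi>' j \<pi>
    proof -
      have "(i, \<pi>' u', j, \<pi>) = (i', u', i, \<pi>')"
        using \<phi> by (intro pairing_unique [of _ _ "(i, \<pi>' u')"]) auto
      then show False using faces_distinct [OF \<phi>(1)] by simp
    qed
    then show ?thesis unfolding M_def src_def tgt_def by (auto, blast)
  qed
  moreover have "B \<inter> (src ` M \<union> tgt ` M) = {}"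
  proof -
    have "\<not> boundary_face \<Phi> i u" "\<not> boundary_face \<Phi> j (\<pi> u)" if "(i, u, j, \<pi>) \<in> \<Phi>" for i u j \<pi>
      using that unfolding boundary_face_def by (auto intro: bexI [of _ "(i, u, j, \<pi>)"])
    then show ?thesis unfolding B_def M_def src_def tgt_def by auto
  qed
  moreover have "P = B \<union> (src ` M \<union> tgt ` M)"
  proof (intro equalityI subsetI)
    fix p assume "p \<in> P"
    then obtain k f v where p: "p = ((k, f), v)" "(k, f) \<in> E" "v \<notin> f" unfolding P_def by blast
    show "p \<in> B \<union> (src ` M \<union> tgt ` M)"
    proof (cases "boundary_face \<Phi> k v")
      case True
      then show ?thesis using p unfolding B_def by blast
    next
      case False
      then obtain i u j \<pi> where \<phi>: "(i, u, j, \<pi>) \<in> \<Phi>" and "(k, v) = (i, u) \<or> (k, v) = (j, \<pi> u)"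
        unfolding boundary_face_def by fastforce
      then show ?thesis
      proof (elim disjE)
        assume "(k, v) = (i, u)"
        then have "(i, u, j, \<pi>, f) \<in> M" "src (i, u, j, \<pi>, f) = p"
          using p \<phi> unfolding M_def src_def by auto
        then show ?thesis by force
      next
        assume kv: "(k, v) = (j, \<pi> u)"
        let ?e = "\<pi> -` f"
        have f: "\<pi> ` ?e = f" using bij_pairing [OF \<phi>] by (simp add: bij_def surj_image_vimage_eq)
        have "u \<notin> ?e" using p kv by simp
        have "is_edge ?e" using edge [OF p(2)] is_edge_image [OF \<phi>, of ?e] f by simp
        have "edge_class \<Phi> i ?e = E"
          using edge_class_glued [OF \<phi> \<open>is_edge ?e\<close> \<open>u \<notin> ?e\<close>] mem_edge(2) [OF E p(2)] f kv by simp
        then have "(i, ?e) \<in> E" using self_in_edge_class by blast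
        then have "(i, u, j, \<pi>, ?e) \<in> M" "tgt (i, u, j, \<pi>, ?e) = p"
          using p kv \<phi> \<open>u \<notin> ?e\<close> f unfolding M_def tgt_def by auto
        then show ?thesis by force
      qed
    qed
  next
    fix p assume "p \<in> B \<union> (src ` M \<union> tgt ` M)"
    then show "p \<in> P"
      unfolding P_def B_def M_def src_def tgt_def using tgt_E by (auto simp: inj_pairing)
  qed
  ultimately have "card P = card B + (card (src ` M) + card (tgt ` M))"
    using \<open>finite M\<close> by (simp add: card_Un_disjoint)
  then have P1: "card P = card B + 2 * card M"
    using \<open>inj_on src M\<close> \<open>inj_on tgt M\<close> by (simp add: card_image)
  have "P = Sigma E (\<lambda>(i, e). - e)" unfolding P_def by auto
  then have "card P = (\<Sum>(i, e)\<in>E. card (- e))" by (simp add: card_SigmaI split_def)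
  also have "\<dots> = (\<Sum>(i, e)\<in>E. 2)"
  proof (rule sum.cong [OF refl], clarify)
    fix i e assume "(i, e) \<in> E"
    then have "card e = 2" using edge unfolding is_edge_def by blast
    then show "card (- e) = 2" by (simp add: Compl_eq_Diff_UNIV card_Diff_subset)
  qed
  finally have P2: "card P = 2 * card E" by simp
  \<comment> \<open>The members of \<open>E\<close> are connected by the gluings in \<open>M\<close>.\<close>
  have "card E \<le> card M + 1"
  proof -
    obtain i e where ie: "is_edge e" "E = edge_class \<Phi> i e" using E by (rule edgesE)
    have "card E \<le> card {p \<in> glue_edge \<Phi>. fst p \<in> E} + 1"
      unfolding ie(2) edge_class_def by (rule card_class_le_card_relation) simp
    also have "{p \<in> glue_edge \<Phi>. fst p \<in> E} \<subseteq> (\<lambda>(i, u, j, \<pi>, e). ((i, e), (j, \<pi> ` e))) ` M"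
      unfolding glue_edge_def M_def by force
    then have "card {p \<in> glue_edge \<Phi>. fst p \<in> E} \<le> card M"
      using \<open>finite M\<close> by (rule surj_card_le [rotated])
    finally show ?thesis by simp
  qed
  with P1 P2 have "card B \<le> 2" "even (card B)" by presburger+
  then have "card B = 0 \<or> card B = 2" by presburger
  moreover have "B = {} \<longleftrightarrow> \<not> boundary_edge \<Phi> E"
    unfolding B_def boundary_edge_def by blast
  then have "card B = 0 \<longleftrightarrow> \<not> boundary_edge \<Phi> E" by (simp add: card_eq_0_iff)
  moreover have "B = Sigma E (\<lambda>(i, e). {u. u \<notin> e \<and> boundary_face \<Phi> i u})" unfolding B_def by auto
  then have "card B = (\<Sum>(i, e)\<in>E. card {u. u \<notin> e \<and> boundary_face \<Phi> i u})"
    by (simp add: card_SigmaI split_def)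
  ultimately show ?thesis by auto
qed

text \<open>
  Summing the local contributions over a class \<open>E\<close>, the reciprocals \<open>2 / d(E)\<close> add up to \<open>2\<close>, and
  each boundary side subtracts \<open>1 / 2\<close>.
\<close>

lemma chi_star_canonical_combination:
  "chi_star \<Phi> (canonical_combination \<Phi> w z)
    = (\<Sum>i\<in>UNIV. w i) + (\<Sum>E\<in>edges \<Phi>. z E * (if boundary_edge \<Phi> E then 1 else 2))"
proof -
  let ?x = "canonical_combination \<Phi> w z"
  define b :: "'t \<Rightarrow> 4 \<Rightarrow> real" where "b i u = of_bool (boundary_face \<Phi> i u)" for i u
  define \<delta> where "\<delta> i e = 1 / real (degree (edge_class \<Phi> i e))" for i e
  have card_b: "real (card {u \<in> A. boundary_face \<Phi> i u}) = (\<Sum>u\<in>A. b i u)" for i and A :: "4 set"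
    unfolding b_def by (simp add: sum_of_bool_eq Int_def)
  have quad: "chi_star_quad \<Phi> i q = - (1/2) * (2 + (\<Sum>u\<in>UNIV. b i u)) + (\<Sum>e\<in>met_edges q. \<delta> i e)" for i q
    unfolding chi_star_quad_def \<delta>_def card_b [of UNIV, simplified] ..
  have "(\<Sum>u\<in>- {v}. b i u) = (\<Sum>u\<in>UNIV. b i u) - b i v" for i v
    by (simp add: Compl_eq_Diff_UNIV sum_diff1)
  then have tri: "chi_star_tri \<Phi> i v
      = - (1/2) * (1 + ((\<Sum>u\<in>UNIV. b i u) - b i v)) + (\<Sum>e | is_edge e \<and> v \<in> e. \<delta> i e)" for i v
    unfolding chi_star_tri_def \<delta>_def using card_b [of "- {v}" i] by simp
  have sides: "(\<Sum>u\<in>UNIV. b i u) - (\<Sum>u\<in>e. b i u) = real (card {u. u \<notin> e \<and> boundary_face \<Phi> i u})" for i e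
    using card_b [of "- e" i] by (simp add: Compl_eq_Diff_UNIV sum_diff)
  have "chi_star \<Phi> ?x = (\<Sum>i\<in>UNIV. (\<Sum>q\<in>UNIV. ?x $ Inl (i, q) * chi_star_quad \<Phi> i q)
      + (\<Sum>v\<in>UNIV. ?x $ Inr (i, v) * chi_star_tri \<Phi> i v))"
    unfolding chi_star_def sum_UNIV_pairs by (simp only: sum.distrib)
  also have "\<dots> = (\<Sum>i\<in>UNIV. w i + (\<Sum>e | is_edge e. z (edge_class \<Phi> i e) *
      (2 * \<delta> i e - real (card {u. u \<notin> e \<and> boundary_face \<Phi> i u}) / 2)))"
    unfolding quad tri sides [symmetric]
    by (simp only: local_combination.weighted_sum_eq [OF local_canonical_combination])
  also have "\<dots> = (\<Sum>i\<in>UNIV. w i) + (\<Sum>E\<in>edges \<Phi>. z E * (\<Sum>(i, e)\<in>E.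
      2 * \<delta> i e - real (card {u. u \<notin> e \<and> boundary_face \<Phi> i u}) / 2))"
    unfolding sum_edge_classes by (simp add: sum.distrib)
  also have "\<dots> = (\<Sum>i\<in>UNIV. w i) + (\<Sum>E\<in>edges \<Phi>. z E * (if boundary_edge \<Phi> E then 1 else 2))"
  proof -
    have "(\<Sum>(i, e)\<in>E. 2 * \<delta> i e - real (card {u. u \<notin> e \<and> boundary_face \<Phi> i u}) / 2)
        = (if boundary_edge \<Phi> E then 1 else 2)" if E: "E \<in> edges \<Phi>" for E
    proof -
      obtain i e where "E = edge_class \<Phi> i e" using E by (rule edgesE)
      then have "card E \<noteq> 0" using self_in_edge_class by (auto simp: card_eq_0_iff)
      have "(\<Sum>(i, e)\<in>E. 2 * \<delta> i e) = (\<Sum>(i, e)\<in>E. 2 / real (card E))"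
        by (rule sum.cong [OF refl]) (auto simp: \<delta>_def degree_def mem_edge(2) [OF E])
      also have "\<dots> = 2" using \<open>card E \<noteq> 0\<close> by (simp add: split_def)
      finally have "(\<Sum>(i, e)\<in>E. 2 * \<delta> i e) = 2" .
      moreover have "(\<Sum>(i, e)\<in>E. real (card {u. u \<notin> e \<and> boundary_face \<Phi> i u}) / 2)
          = real (\<Sum>(i, e)\<in>E. card {u. u \<notin> e \<and> boundary_face \<Phi> i u}) / 2"
        by (simp add: sum_divide_distrib split_def)
      ultimately show ?thesis
        unfolding boundary_sides_of_edge [OF E] by (auto simp: split_def sum_subtractf split: if_splits)
    qed
    then show ?thesis by simp
  qed
  finally show ?thesis .
qed
end

section \<open>Vertex links\<close>

context pseudo_manifold
begin

lemma glued_directed_edge: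
  assumes "((i, a, b), (j, c, d)) \<in> equiv_closure (glue_directed_edge \<Phi>)"
  shows "a \<noteq> b \<longleftrightarrow> c \<noteq> d" "edge_class \<Phi> i {a, b} = edge_class \<Phi> j {c, d}"
proof -
  have step: "(a \<noteq> b \<longleftrightarrow> c \<noteq> d) \<and> edge_class \<Phi> i {a, b} = edge_class \<Phi> j {c, d}"
    if glue: "((i, a, b), (j, c, d)) \<in> glue_directed_edge \<Phi>" for i a b j c d
  proof -
    obtain u \<pi> where "(i, u, j, \<pi>) \<in> \<Phi>" "a \<noteq> b" "a \<noteq> u" "b \<noteq> u" "c = \<pi> a" "d = \<pi> b"
      using glue unfolding glue_directed_edge_def by blast
    then show ?thesis
      using edge_class_glued [of i u j \<pi> "{a, b}"] by (auto simp: inj_pairing is_edge_doubleton)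
  qed
  let ?f = "\<lambda>(i, a, b). (a \<noteq> b, edge_class \<Phi> i {a, b})"
  have "?f (i, a, b) = ?f (j, c, d)"
    using assms
  proof (rule equiv_closure_invariant)
    fix x y assume "(x, y) \<in> glue_directed_edge \<Phi>"
    then show "?f x = ?f y" using step by (cases x, cases y) simp
  qed
  then show "a \<noteq> b \<longleftrightarrow> c \<noteq> d" "edge_class \<Phi> i {a, b} = edge_class \<Phi> j {c, d}" by simp_all
qed

text \<open>
  Gluings of edges lift to gluings of directed edges, like paths to a covering.
\<close>

lemma lift_edge_path:
  assumes "((i, {a, b}), x) \<in> equiv_closure (glue_edge \<Phi>)" "a \<noteq> b"
  shows "\<exists>c d. snd x = {c, d} \<and> ((i, a, b), (fst x, c, d)) \<in> equiv_closure (glue_directed_edge \<Phi>)"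
  using assms(1) unfolding equiv_closure_def
proof (induction rule: rtrancl_induct)
  case base
  show ?case by auto
next
  case (step x y)
  let ?R = "glue_directed_edge \<Phi> \<union> (glue_directed_edge \<Phi>)\<inverse>"
  obtain c d where cd: "snd x = {c, d}" "((i, a, b), (fst x, c, d)) \<in> ?R\<^sup>*"
    using step.IH by blast
  then have "c \<noteq> d"
    using glued_directed_edge(1) \<open>a \<noteq> b\<close> unfolding equiv_closure_def by blast
  have "\<exists>c' d'. snd y = {c', d'} \<and> ((fst x, c, d), (fst y, c', d')) \<in> ?R"
    using step.hyps(2)
  proof
    assume "(x, y) \<in> glue_edge \<Phi>"
    then obtain u \<pi> where \<phi>: "(fst x, u, fst y, \<pi>) \<in> \<Phi>" "u \<notin> snd x" "snd y = \<pi> ` snd x"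
      unfolding glue_edge_def by auto
    then have "((fst x, c, d), (fst y, \<pi> c, \<pi> d)) \<in> glue_directed_edge \<Phi>"
      unfolding glue_directed_edge_def using cd(1) \<open>c \<noteq> d\<close> by auto
    then show ?thesis using \<phi>(3) cd(1) by auto
  next
    assume "(x, y) \<in> (glue_edge \<Phi>)\<inverse>"
    then obtain u \<pi> where \<phi>: "(fst y, u, fst x, \<pi>) \<in> \<Phi>" "u \<notin> snd y" "snd x = \<pi> ` snd y"
      unfolding glue_edge_def by auto
    then have "c \<in> \<pi> ` snd y" "d \<in> \<pi> ` snd y" using cd(1) by auto
    then obtain c' d' where c'd': "c' \<in> snd y" "d' \<in> snd y" "c = \<pi> c'" "d = \<pi> d'" by blast
    then have "\<pi> ` snd y = \<pi> ` {c', d'}" using \<phi>(3) cd(1) by simp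
    then have "snd y = {c', d'}"
      by (rule inj_image_eq_iff [THEN iffD1, OF bij_is_inj [OF bij_pairing [OF \<phi>(1)]]])
    moreover have "((fst y, c', d'), (fst x, c, d)) \<in> glue_directed_edge \<Phi>"
      unfolding glue_directed_edge_def using \<phi> c'd' \<open>c \<noteq> d\<close> by auto
    ultimately show ?thesis by blast
  qed
  then show ?case using cd(2) by (meson rtrancl.rtrancl_into_rtrancl)
qed

text \<open>
  Forgetting directions maps the class of a directed edge onto an edge class.  The map is
  injective because no edge is glued to itself with its direction reversed.
\<close>

lemma card_directed_edge_class:
  assumes "a \<noteq> b"
  shows "card (equiv_closure (glue_directed_edge \<Phi>) `` {(i, a, b)}) = degree (edge_class \<Phi> i {a, b})"
proof -
  let ?C = "equiv_closure (glue_directed_edge \<Phi>) `` {(i, a, b)}"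
  let ?g = "\<lambda>(j, c, d). (j, {c, d})"
  have inj: "inj_on ?g ?C"
  proof (rule inj_onI)
    fix x y assume x: "x \<in> ?C" and y: "y \<in> ?C" and eq: "?g x = ?g y"
    obtain j c d where x': "x = (j, c, d)" by (cases x)
    obtain k c' d' where y': "y = (k, c', d')" by (cases y)
    have "c \<noteq> d" using glued_directed_edge(1) [of i a b j c d] x assms unfolding x' by simp
    have "(x, y) \<in> equiv_closure (glue_directed_edge \<Phi>)"
      using x y by (auto intro: equiv_closure_trans [OF equiv_closure_sym])
    then have "y \<noteq> (j, d, c)" using no_reversed_edge [OF \<open>c \<noteq> d\<close>] unfolding x' by blast
    then show "x = y" using eq unfolding x' y' by (auto simp: doubleton_eq_iff)
  qed
  have img: "?g ` ?C = edge_class \<Phi> i {a, b}"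
  proof (intro equalityI subsetI)
    fix y assume "y \<in> ?g ` ?C"
    then obtain j c d where y: "y = (j, {c, d})" "((i, a, b), (j, c, d)) \<in> equiv_closure (glue_directed_edge \<Phi>)"
      by auto
    then show "y \<in> edge_class \<Phi> i {a, b}"
      using glued_directed_edge(2) [OF y(2)] self_in_edge_class [of j "{c, d}"] by simp
  next
    fix y assume "y \<in> edge_class \<Phi> i {a, b}"
    then obtain c d where "snd y = {c, d}" "((i, a, b), (fst y, c, d)) \<in> equiv_closure (glue_directed_edge \<Phi>)"
      using lift_edge_path [of i a b y] assms unfolding edge_class_def by blast
    then show "y \<in> ?g ` ?C" by (auto intro!: image_eqI [of _ _ "(fst y, c, d)"] simp: prod_eq_iff)
  qed
  show ?thesis using card_image [OF inj] unfolding img degree_def by simp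
qed

text \<open>
  A side of a link triangle lies in a face, and it is glued exactly to its image under the pairing
  of that face, if there is one.
\<close>

lemma card_side_class:
  assumes "a \<noteq> u"
  shows "card (equiv_closure (glue_side \<Phi>) `` {(i, a, u)}) = (if boundary_face \<Phi> i u then 1 else 2)"
proof (cases "boundary_face \<Phi> i u")
  case True
  have "(i, a, u) = y" if "((i, a, u), y) \<in> equiv_closure (glue_side \<Phi>)" for y
  proof -
    have "((i, a, u) = (i, a, u)) \<longleftrightarrow> (y = (i, a, u))"
      using that
    proof (rule equiv_closure_invariant)
      fix x y assume "(x, y) \<in> glue_side \<Phi>"
      then obtain j v k \<pi> b where \<phi>: "(j, v, k, \<pi>) \<in> \<Phi>" "x = (j, b, v)" "y = (k, \<pi> b, \<pi> v)"
        unfolding glue_side_def by blast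
      then have "\<not> boundary_face \<Phi> j v" "\<not> boundary_face \<Phi> k (\<pi> v)"
        unfolding boundary_face_def by (auto intro: bexI [of _ "(j, v, k, \<pi>)"])
      then show "(x = (i, a, u)) \<longleftrightarrow> (y = (i, a, u))" using \<phi> True by auto
    qed
    then show ?thesis by simp
  qed
  then have "equiv_closure (glue_side \<Phi>) `` {(i, a, u)} = {(i, a, u)}"
    using equiv_class_self [OF equiv_equiv_closure UNIV_I, of "(i, a, u)" "glue_side \<Phi>"] by auto
  then show ?thesis using True by simp
next
  case False
  then obtain j v k \<pi> where \<phi>: "(j, v, k, \<pi>) \<in> \<Phi>" and iu: "(i, u) = (j, v) \<or> (i, u) = (k, \<pi> v)"
    unfolding boundary_face_def by fastforce
  \<comment> \<open>The given side may be either the source or the target of its gluing; both cases are reduced to the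
    source \<open>(j, b, v)\<close>.\<close>
  obtain b where b: "b \<noteq> v" "(i, a, u) \<in> {(j, b, v), (k, \<pi> b, \<pi> v)}"
  proof (cases "(i, u) = (j, v)")
    case True
    then show ?thesis using that [of a] assms by auto
  next
    case False
    obtain b where "a = \<pi> b" using bij_pairing [OF \<phi>] by (metis bij_pointE)
    then show ?thesis using that [of b] assms False iu by auto
  qed
  let ?X = "{(j, b, v), (k, \<pi> b, \<pi> v)}"
  have glued: "((j, b, v), (k, \<pi> b, \<pi> v)) \<in> glue_side \<Phi>"
    unfolding glue_side_def using \<phi> b(1) by blast
  have "y \<in> ?X" if "((j, b, v), y) \<in> equiv_closure (glue_side \<Phi>)" for y
  proof -
    have "((j, b, v) \<in> ?X) \<longleftrightarrow> (y \<in> ?X)"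
      using that
    proof (rule equiv_closure_invariant)
      fix x y assume "(x, y) \<in> glue_side \<Phi>"
      then obtain j' v' k' \<pi>' b' where \<psi>: "(j', v', k', \<pi>') \<in> \<Phi>" "x = (j', b', v')" "y = (k', \<pi>' b', \<pi>' v')"
        unfolding glue_side_def by blast
      have same: "(j', v', k', \<pi>') = (j, v, k, \<pi>)" if "x \<in> ?X \<or> y \<in> ?X"
      proof -
        have "(j', v') \<in> paired_faces (j, v, k, \<pi>) \<or> (k', \<pi>' v') \<in> paired_faces (j, v, k, \<pi>)"
          using that \<psi> by auto
        then show ?thesis using pairing_unique [OF \<psi>(1) \<phi>] by auto
      qed
      show "x \<in> ?X \<longleftrightarrow> y \<in> ?X"
      proof (cases "x \<in> ?X \<or> y \<in> ?X")
        case True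
        then show ?thesis
          using same [OF True] \<psi> faces_distinct [OF \<phi>] inj_pairing [OF \<phi>] by auto
      qed simp
    qed
    then show ?thesis by simp
  qed
  then have "equiv_closure (glue_side \<Phi>) `` {(j, b, v)} \<subseteq> ?X" by auto
  moreover have "?X \<subseteq> equiv_closure (glue_side \<Phi>) `` {(j, b, v)}"
    using equiv_closure_incl [OF glued]
      equiv_class_self [OF equiv_equiv_closure UNIV_I, of "(j, b, v)" "glue_side \<Phi>"] by simp
  ultimately have X: "equiv_closure (glue_side \<Phi>) `` {(j, b, v)} = ?X" by (rule equalityI)
  have "equiv_closure (glue_side \<Phi>) `` {(i, a, u)} = equiv_closure (glue_side \<Phi>) `` {(j, b, v)}"
    using b(2) X equiv_closure_class_eq [of "(j, b, v)" "(i, a, u)" "glue_side \<Phi>"] by blast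
  moreover have "card ?X = 2" using faces_distinct [OF \<phi>] by auto
  ultimately show ?thesis using False X by simp
qed

lemma corner_class_invariant:
  assumes "V \<in> vertices \<Phi>" "(i, u, j, \<pi>) \<in> \<Phi>" "a \<noteq> u"
  shows "(i, a) \<in> V \<longleftrightarrow> (j, \<pi> a) \<in> V"
proof -
  obtain x where V: "V = equiv_closure (glue_corner \<Phi>) `` {x}"
    using assms(1) unfolding vertices_def by (auto elim: quotientE)
  have "((i, a), (j, \<pi> a)) \<in> equiv_closure (glue_corner \<Phi>)"
    by (rule equiv_closure_incl) (use assms in \<open>auto simp: glue_corner_def\<close>)
  then show ?thesis
    unfolding V Image_singleton_iff by (blast intro: equiv_closure_trans equiv_closure_sym)
qed

lemma link_coordinate_in_solution_space:
  assumes "V \<in> vertices \<Phi>"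
  shows "link_coordinate V \<in> solution_space \<Phi>"
  unfolding solution_space_def mem_Collect_eq
proof clarify
  fix i u j \<pi> v assume \<phi>: "(i, u, j, \<pi>) \<in> \<Phi>" and "v \<noteq> (u :: 4)"
  then show "arc_weight (link_coordinate V) i u v = arc_weight (link_coordinate V) j (\<pi> u) (\<pi> v)"
    using corner_class_invariant [OF assms \<phi> \<open>v \<noteq> u\<close>]
    by (simp add: arc_weight_def link_coordinate_nth)
qed

text \<open>
  The function \<open>chi_star_tri\<close> counts the cells of the link, shared evenly among the triangles
  containing them: a vertex counts \<open>1 / d(e)\<close>, a side counts \<open>1\<close> or \<open>1 / 2\<close> according to whether
  it lies in the boundary, and the triangle itself counts \<open>1\<close>.
\<close>

lemma euler_char_link_eq_chi_star:
  assumes V: "V \<in> vertices \<Phi>"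
  shows "real_of_int (euler_char_link \<Phi> V) = chi_star \<Phi> (link_coordinate V)"
proof -
  \<comment> \<open>The same set indexes the vertices and the sides of the link triangles before gluing.\<close>
  let ?P = "{(i, a, b). (i, a) \<in> V \<and> a \<noteq> b}"
  have sum_P: "(\<Sum>(i, a, b)\<in>?P. g i a b) = (\<Sum>(i, a)\<in>V. \<Sum>b\<in>- {a}. g i a b)" for g :: "'t \<Rightarrow> 4 \<Rightarrow> 4 \<Rightarrow> real"
  proof -
    have "(\<Sum>(i, a)\<in>V. \<Sum>b\<in>- {a}. g i a b) = (\<Sum>((i, a), b)\<in>Sigma V (\<lambda>(i, a). - {a}). g i a b)"
      by (simp add: sum.Sigma split_def)
    also have "\<dots> = (\<Sum>(i, a, b)\<in>?P. g i a b)"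
      by (rule sum.reindex_bij_witness [of _ "\<lambda>(i, a, b). ((i, a), b)" "\<lambda>((i, a), b). (i, a, b)"]) auto
    finally show ?thesis by simp
  qed
  have P_cong: "(\<Sum>x\<in>?P. f x) = (\<Sum>(i, a, b)\<in>?P. g i a b)"
    if "\<And>i a b. a \<noteq> b \<Longrightarrow> f (i, a, b) = g i a b" for f g
    using that by (intro sum.cong) auto
  have "equiv_closure (glue_directed_edge \<Phi>) `` ?P \<subseteq> ?P"
  proof -
    have "y \<in> ?P" if "x \<in> ?P" "(x, y) \<in> equiv_closure (glue_directed_edge \<Phi>)" for x y
    proof -
      have "x \<in> ?P \<longleftrightarrow> y \<in> ?P"
        using that(2)
        by (rule equiv_closure_invariant)
          (auto simp: glue_directed_edge_def inj_pairing corner_class_invariant [OF V])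
      then show ?thesis using that(1) by simp
    qed
    then show ?thesis by blast
  qed
  then have "real (card (link_0_cells \<Phi> V))
    = (\<Sum>x\<in>?P. 1 / real (card (equiv_closure (glue_directed_edge \<Phi>) `` {x})))"
    unfolding link_0_cells_def by (intro card_quotient_eq_sum equiv_equiv_closure) auto
  also have "\<dots> = (\<Sum>(i, a, b)\<in>?P. 1 / real (degree (edge_class \<Phi> i {a, b})))"
    by (rule P_cong) (simp add: card_directed_edge_class)
  also have "\<dots> = (\<Sum>(i, a)\<in>V. \<Sum>b\<in>- {a}. 1 / real (degree (edge_class \<Phi> i {a, b})))"
    by (rule sum_P)
  also have "\<dots> = (\<Sum>(i, a)\<in>V. \<Sum>e | is_edge e \<and> a \<in> e. 1 / real (degree (edge_class \<Phi> i e)))"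
  proof -
    have neighbours: "(\<Sum>b\<in>- {a}. h {a, b}) = (\<Sum>e | is_edge e \<and> a \<in> e. h e)" for a :: 4 and h :: "4 set \<Rightarrow> real"
    proof -
      have "bij_betw (\<lambda>b. {a, b}) (- {a}) {e. is_edge e \<and> a \<in> e}"
        unfolding bij_betw_def inj_on_def by (auto simp: doubleton_eq_iff is_edge_def card_2_iff)
      then show ?thesis by (rule sum.reindex_bij_betw)
    qed
    show ?thesis
      by (rule sum.cong [OF refl])
        (auto simp: neighbours [of "\<lambda>e. 1 / real (degree (edge_class \<Phi> i e))" for i])
  qed
  finally have c0: "real (card (link_0_cells \<Phi> V))
    = (\<Sum>(i, a)\<in>V. \<Sum>e | is_edge e \<and> a \<in> e. 1 / real (degree (edge_class \<Phi> i e)))" .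
  have "equiv_closure (glue_side \<Phi>) `` ?P \<subseteq> ?P"
  proof -
    have "y \<in> ?P" if "x \<in> ?P" "(x, y) \<in> equiv_closure (glue_side \<Phi>)" for x y
    proof -
      have "x \<in> ?P \<longleftrightarrow> y \<in> ?P"
        using that(2)
        by (rule equiv_closure_invariant)
          (auto simp: glue_side_def inj_pairing corner_class_invariant [OF V])
      then show ?thesis using that(1) by simp
    qed
    then show ?thesis by blast
  qed
  then have "real (card (link_1_cells \<Phi> V))
    = (\<Sum>x\<in>?P. 1 / real (card (equiv_closure (glue_side \<Phi>) `` {x})))"
    unfolding link_1_cells_def by (intro card_quotient_eq_sum equiv_equiv_closure) auto
  also have "\<dots> = (\<Sum>(i, a, u)\<in>?P. 1 / 2 + of_bool (boundary_face \<Phi> i u) / 2)"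
    by (rule P_cong) (simp add: card_side_class)
  also have "\<dots> = (\<Sum>(i, a)\<in>V. \<Sum>u\<in>- {a}. 1 / 2 + of_bool (boundary_face \<Phi> i u) / 2)"
    by (rule sum_P)
  also have "\<dots> = (\<Sum>(i, a)\<in>V. 3 / 2 + real (card {u. u \<noteq> a \<and> boundary_face \<Phi> i u}) / 2)"
  proof -
    have "(\<Sum>u\<in>- {a}. 1 / 2 + of_bool (boundary_face \<Phi> i u) / 2)
        = 3 / 2 + real (card {u. u \<noteq> a \<and> boundary_face \<Phi> i u}) / 2" for i :: 't and a :: 4
    proof -
      have "(\<Sum>u\<in>- {a}. of_bool (boundary_face \<Phi> i u)) = real (card {u. u \<noteq> a \<and> boundary_face \<Phi> i u})"
        by (simp add: sum_of_bool_eq Int_def)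
      moreover have "card (- {a}) = 3"
        by (simp add: Compl_eq_Diff_UNIV)
      ultimately show ?thesis by (simp add: sum.distrib sum_divide_distrib [symmetric])
    qed
    then show ?thesis by simp
  qed
  finally have c1: "real (card (link_1_cells \<Phi> V))
    = (\<Sum>(i, a)\<in>V. 3 / 2 + real (card {u. u \<noteq> a \<and> boundary_face \<Phi> i u}) / 2)" .
  have c2: "real (card V) = (\<Sum>(i, a)\<in>V. 1)" by (simp add: split_def)
  have "chi_star \<Phi> (link_coordinate V) = (\<Sum>c\<in>UNIV. if c \<in> V then chi_star_tri \<Phi> (fst c) (snd c) else 0)"
    unfolding chi_star_def by (simp add: link_coordinate_nth split_def if_distrib [of "\<lambda>x. x * _"] cong: if_cong)
  also have "\<dots> = (\<Sum>(i, a)\<in>V. chi_star_tri \<Phi> i a)"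
    by (simp add: sum.If_cases split_def)
  also have "\<dots> = real_of_int (euler_char_link \<Phi> V)"
    unfolding euler_char_link_def of_int_add of_int_diff of_int_of_nat_eq c0 c1 c2
      sum_subtractf [symmetric] sum.distrib [symmetric]
    by (intro sum.cong refl) (auto simp: chi_star_tri_def field_simps)
  finally show ?thesis by simp
qed
end

section \<open>Convexity\<close>

text \<open>
  Farkas' lemma.  A finitely generated cone is polyhedral, hence closed, so a point outside is
  strictly separated from it by a hyperplane; since the cone is invariant under scaling, the
  hyperplane may be moved to the origin.
\<close>

lemma farkas_alternative:
  fixes c :: "'k::finite \<Rightarrow> 'a::euclidean_space"
  obtains (nonneg) \<beta> where "\<And>k. 0 \<le> \<beta> k" "b = (\<Sum>k\<in>UNIV. \<beta> k *\<^sub>R c k)"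
    | (separated) y where "\<And>k. 0 \<le> y \<bullet> c k" "y \<bullet> b < 0"
proof -
  let ?K = "convex_cone hull (range c)"
  show thesis
  proof (cases "b \<in> ?K")
    case True
    let ?S = "{\<Sum>k\<in>UNIV. \<beta> k *\<^sub>R c k | \<beta>. \<forall>k. 0 \<le> \<beta> k}"
    have "convex_cone ?S"
    proof (unfold convex_cone_iff, intro conjI allI impI ballI)
      show "0 \<in> ?S" by (auto intro: exI [of _ "\<lambda>k. 0"])
    next
      fix x y assume "x \<in> ?S" "y \<in> ?S"
      then obtain \<beta> \<gamma> where "\<forall>k. 0 \<le> \<beta> k" "\<forall>k. 0 \<le> \<gamma> k"
        "x = (\<Sum>k\<in>UNIV. \<beta> k *\<^sub>R c k)" "y = (\<Sum>k\<in>UNIV. \<gamma> k *\<^sub>R c k)" by blast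
      then show "x + y \<in> ?S"
        by (auto simp: scaleR_add_left sum.distrib intro!: exI [of _ "\<lambda>k. \<beta> k + \<gamma> k"])
    next
      fix x and t :: real assume "x \<in> ?S" "0 \<le> t"
      then obtain \<beta> where "\<forall>k. 0 \<le> \<beta> k" "x = (\<Sum>k\<in>UNIV. \<beta> k *\<^sub>R c k)" by blast
      then show "t *\<^sub>R x \<in> ?S"
        using \<open>0 \<le> t\<close> by (auto simp: scaleR_sum_right intro!: exI [of _ "\<lambda>k. t * \<beta> k"])
    qed
    moreover have "c k \<in> ?S" for k
      by (auto simp: if_distrib [of "\<lambda>x. x *\<^sub>R _"] sum.delta cong: if_cong
          intro!: exI [of _ "\<lambda>j. if j = k then 1 else 0"])
    ultimately have "?K \<subseteq> ?S" by (intro hull_minimal) auto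
    then show thesis using True nonneg by blast
  next
    case False
    have "closed ?K" by (intro polyhedron_imp_closed polyhedron_convex_cone_hull) simp
    with False obtain y l where y: "y \<bullet> b < l" "\<And>x. x \<in> ?K \<Longrightarrow> l < y \<bullet> x"
      using separating_hyperplane_closed_point [OF convex_convex_cone_hull] by metis
    have "l < 0" using y(2) [OF convex_cone_hull_contains_0] by simp
    have "0 \<le> y \<bullet> c k" for k
    proof (rule ccontr)
      assume neg: "\<not> 0 \<le> y \<bullet> c k"
      define t where "t = l / (y \<bullet> c k)"
      have "0 \<le> t" using neg \<open>l < 0\<close> by (simp add: t_def divide_nonpos_neg)
      then have "t *\<^sub>R c k \<in> ?K" by (intro convex_cone_hull_mul hull_inc) auto
      then have "l < t * (y \<bullet> c k)" using y(2) by fastforce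
      then show False using neg by (simp add: t_def)
    qed
    then show thesis using separated y(1) \<open>l < 0\<close> by force
  qed
qed

lemma subspace_solution_space: "subspace (solution_space \<Phi>)"
proof -
  have "arc_weight 0 i u v = 0" "arc_weight (x + y) i u v = arc_weight x i u v + arc_weight y i u v"
    "arc_weight (c *\<^sub>R x) i u v = c * arc_weight x i u v" for x y :: "real ^ 'a disc" and c i u v
    unfolding arc_weight_def by (simp_all add: sum.distrib sum_distrib_left distrib_left)
  then show ?thesis unfolding subspace_def solution_space_def by fastforce
qed

lemma projective_solution_space:
  "compact (projective_solution_space \<Phi>)" "convex (projective_solution_space \<Phi>)"
proof -
  have eq: "projective_solution_space \<Phi>
    = solution_space \<Phi> \<inter> ((\<Inter>D. {x. 0 \<le> x $ D}) \<inter> {x. (\<Sum>D\<in>UNIV. x $ D) = 1})"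
    unfolding projective_solution_space_def by auto
  have "closed (projective_solution_space \<Phi>)"
    unfolding eq
    by (intro closed_Int closed_subspace subspace_solution_space closed_INT ballI
        closed_Collect_le closed_Collect_eq continuous_intros)
  moreover have "norm x \<le> 1" if "x \<in> projective_solution_space \<Phi>" for x
    using norm_le_l1_cart [of x] that unfolding projective_solution_space_def by simp
  then have "bounded (projective_solution_space \<Phi>)" by (rule boundedI)
  ultimately show "compact (projective_solution_space \<Phi>)" by (simp add: compact_eq_bounded_closed)
  show "convex (projective_solution_space \<Phi>)"
  proof (rule convexI)
    fix x y and u v :: real
    assume "x \<in> projective_solution_space \<Phi>" "y \<in> projective_solution_space \<Phi>" "0 \<le> u" "0 \<le> v" "u + v = 1"
    then show "u *\<^sub>R x + v *\<^sub>R y \<in> projective_solution_space \<Phi>"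
      unfolding projective_solution_space_def
      by (auto simp: sum.distrib sum_distrib_left [symmetric]
          intro: subspace_add subspace_scale subspace_solution_space)
  qed
qed

section \<open>Existence of semi-angle structures\<close>

context pseudo_manifold
begin

text \<open>
  The linear function \<open>L\<close> whose sign the equivalent conditions describe.
\<close>

definition defect :: "(('t \<times> 4 set) set \<Rightarrow> real) \<Rightarrow> real ^ 't disc \<Rightarrow> real" where
  "defect \<kappa> s = chi_curv \<Phi> \<kappa> s - chi_star \<Phi> s"

lemma defect_canonical_combination:
  "defect \<kappa> (canonical_combination \<Phi> w z)
    = (\<Sum>E\<in>edges \<Phi>. z E * (\<kappa> E / pi - (if boundary_edge \<Phi> E then 1 else 2))) - (\<Sum>i\<in>UNIV. w i)"
  unfolding defect_def chi_curv_canonical_combination chi_star_canonical_combination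
  by (simp add: right_diff_distrib sum_subtractf sum_divide_distrib)

lemma defect_combination:
  assumes "s \<in> solution_space \<Phi>" "t \<in> solution_space \<Phi>"
  shows "defect \<kappa> (a *\<^sub>R s + b *\<^sub>R t) = a * defect \<kappa> s + b * defect \<kappa> t"
proof -
  obtain w z where s: "s = canonical_combination \<Phi> w z"
    using assms(1) by (rule solution_is_canonical_combination)
  obtain w' z' where t: "t = canonical_combination \<Phi> w' z'"
    using assms(2) by (rule solution_is_canonical_combination)
  have "a *\<^sub>R s + b *\<^sub>R t = canonical_combination \<Phi> (\<lambda>i. a * w i + b * w' i) (\<lambda>E. a * z E + b * z' E)"
    unfolding s t canonical_combination_def
    by (simp add: scaleR_add_left scaleR_add_right scaleR_sum_right sum.distrib)
  then show ?thesis
    unfolding s t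
    by (simp add: defect_canonical_combination sum.distrib sum_distrib_left sum_subtractf algebra_simps)
qed

text \<open>
  For angles of area zero, the angles of the two wedges facing a quadrilateral type coincide;
  their mean is used as the coefficient because it treats the two edges alike.
\<close>

lemma defect_semi_angle_structure:
  assumes \<alpha>: "semi_angle_structure \<Phi> \<kappa> \<alpha>" and s: "s \<in> solution_space \<Phi>"
  shows "defect \<kappa> s
    = (\<Sum>i\<in>UNIV. \<Sum>q\<in>UNIV. s $ Inl (i, q) * ((\<Sum>e\<in>faced_edges q. \<alpha> (i, e)) / 2)) / pi"
proof -
  obtain w z where wz: "s = canonical_combination \<Phi> w z"
    using s by (rule solution_is_canonical_combination)
  have area: "(\<Sum>e | is_edge e \<and> v \<in> e. \<alpha> (i, e)) = pi" for i v
    using \<alpha> unfolding semi_angle_structure_def area_def by simp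
  have \<kappa>: "\<kappa> E / pi - (if boundary_edge \<Phi> E then 1 else 2) = - (\<Sum>(i, e)\<in>E. \<alpha> (i, e)) / pi"
    if "E \<in> edges \<Phi>" for E
  proof -
    have "\<kappa> E = (if boundary_edge \<Phi> E then pi else 2 * pi) - (\<Sum>(i, e)\<in>E. \<alpha> (i, e))"
      using \<alpha> that unfolding semi_angle_structure_def curvature_def by simp
    then show ?thesis by (simp add: diff_divide_distrib)
  qed
  have "(\<Sum>E\<in>edges \<Phi>. z E * (\<kappa> E / pi - (if boundary_edge \<Phi> E then 1 else 2)))
      = - (\<Sum>E\<in>edges \<Phi>. z E * (\<Sum>(i, e)\<in>E. \<alpha> (i, e))) / pi"
    by (simp add: \<kappa> sum_negf sum_divide_distrib [symmetric])
  then have "defect \<kappa> s = - (\<Sum>E\<in>edges \<Phi>. z E * (\<Sum>(i, e)\<in>E. \<alpha> (i, e))) / pi - (\<Sum>i\<in>UNIV. w i)"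
    unfolding wz defect_canonical_combination by (simp only:)
  also have "\<dots> = (\<Sum>i\<in>UNIV. - (w i * pi) - (\<Sum>e | is_edge e. z (edge_class \<Phi> i e) * \<alpha> (i, e))) / pi"
    unfolding sum_edge_classes
    by (simp add: sum_subtractf sum_negf sum_distrib_right [symmetric] diff_divide_distrib)
  finally show ?thesis
    unfolding wz by (simp only: local_combination.angle_pairing_eq [OF local_canonical_combination area])
qed

text \<open>
  Unknown are the angles of quadrilateral types, divided by \<open>\<pi>\<close>.  They must satisfy one equation
  for each tetrahedron (their sum is \<open>1\<close>) and one for each edge class (prescribed curvature).  A
  vector \<open>y\<close> witnessing that this system has no non-negative solution is, up to sign, the
  coefficient vector of a solution \<open>s\<close> of the matching equations with non-negative quadrilateral
  coordinates and \<open>L(s) < 0\<close>.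
\<close>

lemma semi_angle_structure_exists:
  assumes nonneg: "\<And>s. s \<in> solution_space \<Phi> \<Longrightarrow> (\<And>i q. 0 \<le> s $ Inl (i, q)) \<Longrightarrow> 0 \<le> defect \<kappa> s"
  shows "\<exists>\<alpha>. semi_angle_structure \<Phi> \<kappa> \<alpha>"
proof -
  \<comment> \<open>\<open>c (i, q)\<close> is the column of the unknown \<open>(i, q)\<close> and \<open>b\<close> the right-hand side, which vanishes at the
    sets \<open>E\<close> that are not edge classes.\<close>
  define c :: "'t \<times> quad \<Rightarrow> real ^ ('t + ('t \<times> 4 set) set)" where
    "c = (\<lambda>(i, q). axis (Inl i) 1 + (\<Sum>e\<in>faced_edges q. axis (Inr (edge_class \<Phi> i e)) 1))"
  define r where "r E = (if E \<in> edges \<Phi> then (if boundary_edge \<Phi> E then 1 else 2) - \<kappa> E / pi else 0)" for E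
  define b :: "real ^ ('t + ('t \<times> 4 set) set)" where
    "b = (\<chi> k. case k of Inl i \<Rightarrow> 1 | Inr E \<Rightarrow> r E)"
  show ?thesis
  proof (cases rule: farkas_alternative [of b c])
    case (separated y)
    let ?s = "canonical_combination \<Phi> (\<lambda>i. - y $ Inl i) (\<lambda>E. - y $ Inr E)"
    have "?s $ Inl (i, q) = y \<bullet> c (i, q)" for i q
      unfolding local_combination.quad [OF local_canonical_combination] c_def
      by (simp add: inner_add_right inner_sum_right inner_axis sum_negf)
    then have "0 \<le> defect \<kappa> ?s"
      using separated(1) by (intro nonneg canonical_combination_in_solution_space) simp
    moreover have "y \<bullet> b = defect \<kappa> ?s"
    proof -
      have "y \<bullet> b = (\<Sum>i\<in>UNIV. y $ Inl i) + (\<Sum>E\<in>UNIV. y $ Inr E * r E)"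
        unfolding inner_vec_def b_def UNIV_Plus_UNIV [symmetric] by (subst sum.Plus) simp_all
      also have "(\<Sum>E\<in>UNIV. y $ Inr E * r E)
          = (\<Sum>E\<in>edges \<Phi>. y $ Inr E * ((if boundary_edge \<Phi> E then 1 else 2) - \<kappa> E / pi))"
        by (rule sum.mono_neutral_cong_right) (auto simp: r_def)
      finally show ?thesis
        unfolding defect_canonical_combination
        by (simp add: sum_negf sum_subtractf algebra_simps)
    qed
    ultimately show ?thesis using separated(2) by simp
  next
    case (nonneg \<beta>)
    define \<alpha> where "\<alpha> = (\<lambda>(i, e). pi * (\<Sum>q | e \<in> faced_edges q. \<beta> (i, q)))"
    have b: "b $ k = (\<Sum>i\<in>UNIV. \<Sum>q\<in>UNIV. \<beta> (i, q) * c (i, q) $ k)" for k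
      unfolding nonneg(2) by (simp add: sum_component sum_UNIV_pairs [symmetric] split_def)
    have total: "(\<Sum>q\<in>UNIV. \<beta> (i, q)) = 1" for i
    proof -
      have "c (j, q) $ Inl i = (if j = i then 1 else 0)" for j q
        unfolding c_def by (simp add: sum_component axis_def)
      then have "b $ Inl i = (\<Sum>j\<in>UNIV. if j = i then \<Sum>q\<in>UNIV. \<beta> (i, q) else 0)"
        unfolding b by (intro sum.cong) auto
      then show ?thesis by (simp add: b_def)
    qed
    have class_total: "(\<Sum>(i, e)\<in>E. \<alpha> (i, e)) = pi * r E" if E: "E \<in> edges \<Phi>" for E
    proof -
      have "c (i, q) $ Inr E = (\<Sum>e\<in>faced_edges q. of_bool (edge_class \<Phi> i e = E))" for i q
        unfolding c_def by (simp add: sum_component axis_def of_bool_def eq_commute)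
      then have "r E = (\<Sum>i\<in>UNIV. \<Sum>q\<in>UNIV. \<beta> (i, q) * (\<Sum>e\<in>faced_edges q. of_bool (edge_class \<Phi> i e = E)))"
        using b [of "Inr E"] by (simp add: b_def)
      also have "\<dots> = (\<Sum>F\<in>edges \<Phi>. of_bool (F = E) * (\<Sum>(i, e)\<in>F. \<Sum>q | e \<in> faced_edges q. \<beta> (i, q)))"
        unfolding sum_edge_classes sum_edges_faced_swap ..
      also have "\<dots> = (\<Sum>(i, e)\<in>E. \<Sum>q | e \<in> faced_edges q. \<beta> (i, q))"
        using E by (simp add: of_bool_def if_distrib [of "\<lambda>x. x * _"] sum.delta' cong: if_cong)
      finally show ?thesis by (simp add: \<alpha>_def sum_distrib_left split_def)
    qed
    have "semi_angle_structure \<Phi> \<kappa> \<alpha>"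
      unfolding semi_angle_structure_def
    proof (intro conjI allI impI ballI)
      show "0 \<le> \<alpha> (i, e)" for i e
        using nonneg(1) by (simp add: \<alpha>_def sum_nonneg)
      show "area \<alpha> i v = 0" for i v
        unfolding area_def \<alpha>_def prod.case sum_distrib_left [symmetric] sum_quads_at_vertex total by simp
      show "curvature \<Phi> \<alpha> E = \<kappa> E" if "E \<in> edges \<Phi>" for E
        unfolding curvature_def class_total [OF that] using that by (simp add: r_def field_simps)
    qed
    then show ?thesis by blast
  qed
qed

text \<open>
  The sum \<open>T\<close> of all vertex links contains each triangle type once and no quadrilateral.  For
  large \<open>c\<close> the vector \<open>s + c T\<close> is non-negative and non-zero, hence a positive multiple of a
  projective solution, and \<open>L(s + c T) = L(s)\<close>.
\<close>

lemma defect_nonneg_of_links: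
  assumes links: "\<And>V. V \<in> vertices \<Phi> \<Longrightarrow> defect \<kappa> (link_coordinate V) = 0"
    and proj: "\<And>s. s \<in> projective_solution_space \<Phi> \<Longrightarrow> 0 \<le> defect \<kappa> s"
    and s: "s \<in> solution_space \<Phi>" "\<And>i q. 0 \<le> s $ Inl (i, q)"
  shows "0 \<le> defect \<kappa> s"
proof -
  define T where "T = (\<Sum>V\<in>vertices \<Phi>. link_coordinate V)"
  have "(\<Sum>V\<in>F. link_coordinate V) \<in> solution_space \<Phi> \<and> defect \<kappa> (\<Sum>V\<in>F. link_coordinate V) = 0"
    if "F \<subseteq> vertices \<Phi>" for F
    using finite [of F] that
  proof (induction F rule: finite_induct)
    case empty
    have "0 \<in> solution_space \<Phi>" by (rule subspace_0 [OF subspace_solution_space])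
    then show ?case using defect_combination [of 0 0 \<kappa> 0 0] by simp
  next
    case (insert V F)
    then show ?case
      using link_coordinate_in_solution_space [of V] links [of V]
        defect_combination [of "link_coordinate V" "\<Sum>V\<in>F. link_coordinate V" \<kappa> 1 1]
      by (auto intro: subspace_add [OF subspace_solution_space])
  qed
  then have T: "T \<in> solution_space \<Phi>" "defect \<kappa> T = 0" unfolding T_def by auto
  have T_quad: "T $ Inl p = 0" for p
    unfolding T_def by (cases p) (simp add: sum_component link_coordinate_nth)
  have T_tri: "1 \<le> T $ Inr p" for p
  proof -
    let ?V = "equiv_closure (glue_corner \<Phi>) `` {p}"
    have "?V \<in> vertices \<Phi>" "p \<in> ?V"
      using equiv_class_self [OF equiv_equiv_closure UNIV_I, of p "glue_corner \<Phi>"]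
      unfolding vertices_def by (auto intro: quotientI)
    then have "(1::real) = link_coordinate ?V $ Inr p" by (simp add: link_coordinate_nth)
    also have "\<dots> \<le> (\<Sum>V\<in>vertices \<Phi>. link_coordinate V $ Inr p)"
      by (rule member_le_sum [OF \<open>?V \<in> vertices \<Phi>\<close>]) (simp_all add: link_coordinate_nth)
    finally show ?thesis unfolding T_def by (simp add: sum_component)
  qed
  \<comment> \<open>The summand \<open>1\<close> makes the triangle coordinates of \<open>x\<close> positive, so that \<open>x\<close> can be normalised even
    when \<open>s = 0\<close>.\<close>
  define c where "c = 1 + (\<Sum>D\<in>UNIV. \<bar>s $ D\<bar>)"
  have "0 \<le> c" unfolding c_def by (simp add: sum_nonneg)
  define x where "x = s + c *\<^sub>R T"
  have x: "x \<in> solution_space \<Phi>"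
    unfolding x_def using s(1) T(1) by (intro subspace_add subspace_scale subspace_solution_space)
  have x_quad: "0 \<le> x $ Inl p" for p
    unfolding x_def using s(2) [of "fst p" "snd p"] by (simp add: T_quad)
  have x_tri: "1 \<le> x $ Inr p" for p
  proof -
    have "\<bar>s $ Inr p\<bar> \<le> (\<Sum>D\<in>UNIV. \<bar>s $ D\<bar>)" by (rule member_le_sum) auto
    moreover have "c * 1 \<le> c * T $ Inr p" using T_tri \<open>0 \<le> c\<close> by (rule mult_left_mono)
    ultimately show ?thesis unfolding x_def c_def by simp
  qed
  have x_nonneg: "0 \<le> x $ D" for D
    using x_quad order_trans [OF zero_le_one x_tri] by (cases D) auto
  define m where "m = (\<Sum>D\<in>UNIV. x $ D)"
  have "x $ Inr undefined \<le> m" unfolding m_def by (rule member_le_sum) (auto intro: x_nonneg)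
  then have "0 < m" using x_tri [of undefined] by linarith
  have "(1 / m) *\<^sub>R x \<in> projective_solution_space \<Phi>"
    unfolding projective_solution_space_def
    using \<open>0 < m\<close> x_nonneg x
    by (auto simp: sum_distrib_left [symmetric] m_def [symmetric] sum_divide_distrib [symmetric]
        intro: subspace_scale subspace_solution_space)
  then have "0 \<le> defect \<kappa> ((1 / m) *\<^sub>R x)" by (rule proj)
  also have "\<dots> = (1 / m) * defect \<kappa> x" using defect_combination [OF x x, of \<kappa> "1 / m" 0] by simp
  finally have "0 \<le> defect \<kappa> x" using \<open>0 < m\<close> by (simp add: zero_le_divide_iff)
  also have "defect \<kappa> x = defect \<kappa> s"
    unfolding x_def using defect_combination [OF s(1) T(1), of \<kappa> 1 c] T(2) by simp
  finally show ?thesis .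
qed

lemma defect_nonneg_of_vertex_solutions:
  assumes vert: "\<And>s. s \<in> vertex_solutions \<Phi> \<Longrightarrow> 0 \<le> defect \<kappa> s"
    and "s \<in> projective_solution_space \<Phi>"
  shows "0 \<le> defect \<kappa> s"
proof -
  let ?P = "projective_solution_space \<Phi>"
  have sub: "?P \<subseteq> solution_space \<Phi>" unfolding projective_solution_space_def by blast
  have hull: "?P = convex hull (vertex_solutions \<Phi>)"
    unfolding vertex_solutions_def by (intro Krein_Milman_Minkowski projective_solution_space)
  have "convex {s \<in> ?P. 0 \<le> defect \<kappa> s}"
  proof (rule convexI)
    fix x y and u v :: real
    assume *: "x \<in> {s \<in> ?P. 0 \<le> defect \<kappa> s}" "y \<in> {s \<in> ?P. 0 \<le> defect \<kappa> s}" "0 \<le> u" "0 \<le> v" "u + v = 1"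
    then have "u *\<^sub>R x + v *\<^sub>R y \<in> ?P"
      using convexD [OF projective_solution_space(2)] by blast
    moreover have "defect \<kappa> (u *\<^sub>R x + v *\<^sub>R y) = u * defect \<kappa> x + v * defect \<kappa> y"
      using * sub by (intro defect_combination) auto
    ultimately show "u *\<^sub>R x + v *\<^sub>R y \<in> {s \<in> ?P. 0 \<le> defect \<kappa> s}" using * by simp
  qed
  moreover have "vertex_solutions \<Phi> \<subseteq> {s \<in> ?P. 0 \<le> defect \<kappa> s}"
    using vert unfolding vertex_solutions_def extreme_point_of_def by blast
  ultimately have "convex hull (vertex_solutions \<Phi>) \<subseteq> {s \<in> ?P. 0 \<le> defect \<kappa> s}"
    by (intro hull_minimal)
  moreover have "s \<in> convex hull (vertex_solutions \<Phi>)" using assms(2) hull by simp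
  ultimately show ?thesis by blast
qed

lemma semi_angle_structure_consequences:
  assumes \<alpha>: "semi_angle_structure \<Phi> \<kappa> \<alpha>"
  shows "\<And>s. s \<in> solution_space \<Phi> \<Longrightarrow> (\<And>i q. 0 \<le> s $ Inl (i, q)) \<Longrightarrow> 0 \<le> defect \<kappa> s"
    and "\<And>V. V \<in> vertices \<Phi> \<Longrightarrow> defect \<kappa> (link_coordinate V) = 0"
proof -
  have angle: "0 \<le> (\<Sum>e\<in>faced_edges q. \<alpha> (i, e))" for i q
  proof (rule sum_nonneg)
    fix e assume "e \<in> faced_edges q"
    then have "is_edge e" by (cases q) (auto simp: is_edge_doubleton)
    then show "0 \<le> \<alpha> (i, e)" using \<alpha> unfolding semi_angle_structure_def by blast
  qed
  show "0 \<le> defect \<kappa> s" if s: "s \<in> solution_space \<Phi>" "\<And>i q. 0 \<le> s $ Inl (i, q)" for s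
  proof -
    have "0 \<le> s $ Inl (i, q) * ((\<Sum>e\<in>faced_edges q. \<alpha> (i, e)) / 2)" for i q
      using s(2) [of i q] angle [of i q] by simp
    then show ?thesis
      unfolding defect_semi_angle_structure [OF \<alpha> s(1)]
      by (intro divide_nonneg_pos sum_nonneg) simp_all
  qed
  show "defect \<kappa> (link_coordinate V) = 0" if "V \<in> vertices \<Phi>" for V
    unfolding defect_semi_angle_structure [OF \<alpha> link_coordinate_in_solution_space [OF that]]
    by (simp add: link_coordinate_nth)
qed

end

theorem corollary19:
  fixes \<Phi> :: "'t::finite pairing set"
    and \<kappa> :: "('t \<times> 4 set) set \<Rightarrow> real"
  assumes "triangulated_pseudo_manifold \<Phi>"
  shows
    "((\<exists>\<alpha>. semi_angle_structure \<Phi> \<kappa> \<alpha>)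
        \<longleftrightarrow> (\<forall>s\<in>solution_space \<Phi>. (\<forall>i q. 0 \<le> s $ Inl (i, q)) \<longrightarrow> chi_star \<Phi> s \<le> chi_curv \<Phi> \<kappa> s)) \<and>
     ((\<exists>\<alpha>. semi_angle_structure \<Phi> \<kappa> \<alpha>)
        \<longleftrightarrow> (\<forall>V\<in>vertices \<Phi>. real_of_int (euler_char_link \<Phi> V) = chi_curv \<Phi> \<kappa> (link_coordinate V)) \<and>
            (\<forall>s\<in>projective_solution_space \<Phi>. chi_star \<Phi> s \<le> chi_curv \<Phi> \<kappa> s)) \<and>
     ((\<exists>\<alpha>. semi_angle_structure \<Phi> \<kappa> \<alpha>)
        \<longleftrightarrow> (\<forall>V\<in>vertices \<Phi>. real_of_int (euler_char_link \<Phi> V) = chi_curv \<Phi> \<kappa> (link_coordinate V)) \<and>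
            (\<forall>s\<in>vertex_solutions \<Phi>. chi_star \<Phi> s \<le> chi_curv \<Phi> \<kappa> s))"
proof -
  interpret pseudo_manifold \<Phi> by unfold_locales (rule assms)
  have le: "chi_star \<Phi> s \<le> chi_curv \<Phi> \<kappa> s \<longleftrightarrow> 0 \<le> defect \<kappa> s" for s
    unfolding defect_def by simp
  have links: "(\<forall>V\<in>vertices \<Phi>. real_of_int (euler_char_link \<Phi> V) = chi_curv \<Phi> \<kappa> (link_coordinate V))
      \<longleftrightarrow> (\<forall>V\<in>vertices \<Phi>. defect \<kappa> (link_coordinate V) = 0)"
    by (auto simp: euler_char_link_eq_chi_star defect_def)
  let ?one = "\<exists>\<alpha>. semi_angle_structure \<Phi> \<kappa> \<alpha>"
  let ?two = "\<forall>s\<in>solution_space \<Phi>. (\<forall>i q. 0 \<le> s $ Inl (i, q)) \<longrightarrow> 0 \<le> defect \<kappa> s"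
  let ?links = "\<forall>V\<in>vertices \<Phi>. defect \<kappa> (link_coordinate V) = 0"
  let ?three = "\<forall>s\<in>projective_solution_space \<Phi>. 0 \<le> defect \<kappa> s"
  let ?four = "\<forall>s\<in>vertex_solutions \<Phi>. 0 \<le> defect \<kappa> s"
  have "?one \<Longrightarrow> ?two" "?one \<Longrightarrow> ?links" using semi_angle_structure_consequences by blast+
  moreover have "?two \<Longrightarrow> ?one" using semi_angle_structure_exists by blast
  moreover have "?two \<Longrightarrow> ?three" unfolding projective_solution_space_def by blast
  moreover have "?links \<Longrightarrow> ?three \<Longrightarrow> ?two" using defect_nonneg_of_links by blast
  moreover have "?three \<Longrightarrow> ?four" unfolding vertex_solutions_def extreme_point_of_def by blast
  moreover have "?four \<Longrightarrow> ?three" using defect_nonneg_of_vertex_solutions by blast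
  ultimately show ?thesis unfolding le links by argo
qed

end
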